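(* Let $D\subset\Omega\subset\square\subset\mathbb{R}^d$ be domains and $m\in\mathbb{N}$. Let $E_D:H_0^m(D)\to H_0^m(\Omega)$ and $E_\square:H_0^m(\Omega)\to H_0^m(\square)$ be the zero-extension operators, let $\mathcal{V}(\Omega):=E_D(H_0^m(D))\subset H_0^m(\Omega)$ and $\mathcal{U}(\square):=E_\square(H_0^m(\Omega))\subset H_0^m(\square)$ be their ranges (with inherited norms), and let $R_\square:\mathcal{U}(\square)\to H_0^m(\Omega)$ be the inverse of $E_\square:H^m_0(\Omega)\to\mathcal{U}(\square)$. Let $r_\Omega\in H^{-m}(\Omega)$ and set $r_D:=E_D'\big(r_\Omega|_{\mathcal{V}(\Omega)}\big)\in H^{-m}(D)$. Then $$\|r_D\|_{H^{-m}(D)}\le\|r_\Omega\|_{H^{-m}(\Omega)}\le\|r_\square\|_{H^{-m}(\square)}\qquad\text{for all } r_\square\in\mathcal{E}(R_\square' r_\Omega;H^{-m}(\square)).$$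
   Context: $H_0^m(G)$ is the real Sobolev space, i.e. the closure of $C_c^\infty(G)$ in $H^m(G)$, with the norm $\|u\|_{H^m(G)}^2=\sum_{|\alpha|\le m}\|D^\alpha u\|_{L_2(G)}^2$; $H^{-m}(G):=(H_0^m(G))'$ with the dual norm $\|f\|=\sup_{v\ne0}f(v)/\|v\|$. The zero-extension operator from $G_1$ to $G_2\supset G_1$ maps $u\in H_0^m(G_1)$ to the function on $G_2$ equal to $u$ on $G_1$ and $0$ on $G_2\setminus G_1$; this lies in $H_0^m(G_2)$. The adjoint of a continuous linear $T:A\to B$ is $T':B'\to A'$, $T'g=g\circ T$; so $R_\square' r_\Omega\in\mathcal{U}'(\square)$ is $u\mapsto r_\Omega(R_\square u)$, and $E_D'$ (with $E_D$ regarded as a map onto $\mathcal{V}(\Omega)$) maps $s\in\mathcal{V}'(\Omega)$ to $v\mapsto s(E_Dv)$. For a subspace $A\subset B$ with inherited norm and $r\in A'$, $\mathcal{E}(r;B'):=\{\tilde r\in B':\tilde r=r\text{ on }A\}$. *)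

theory Defs
  imports "HOL-Analysis.Analysis"
begin

section \<open>Normed spaces with explicit carriers\<close>

text \<open>The spaces below depend on a set \<open>G\<close>, so they are not types; a normed space is given by its
  carrier and its operations. The operations are only meaningful on the carrier.\<close>

record 'a normed_sp =
  carr :: "'a set"
  add :: "'a \<Rightarrow> 'a \<Rightarrow> 'a"
  scl :: "real \<Rightarrow> 'a \<Rightarrow> 'a"
  zer :: 'a
  nrm :: "'a \<Rightarrow> real"

definition subsp :: "'a normed_sp \<Rightarrow> 'a set \<Rightarrow> 'a normed_sp" where
  "subsp X A = X\<lparr>carr := A\<rparr>"

definition norm_closure :: "'a normed_sp \<Rightarrow> 'a set \<Rightarrow> 'a set" where
  "norm_closure X A =
     {x \<in> carr X. \<forall>e>0. \<exists>a\<in>A. nrm X (add X x (scl X (-1) a)) < e}"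

text \<open>A functional is a function on the carrier only: it is \<^const>\<open>extensional\<close>, hence equal to
  \<^const>\<open>undefined\<close> off the carrier, so that equality in the dual is equality on the carrier.\<close>

definition dual :: "'a normed_sp \<Rightarrow> ('a \<Rightarrow> real) set" where
  "dual X = {f \<in> extensional (carr X).
     (\<forall>u\<in>carr X. \<forall>v\<in>carr X. f (add X u v) = f u + f v) \<and>
     (\<forall>c. \<forall>u\<in>carr X. f (scl X c u) = c * f u) \<and>
     (\<exists>C. \<forall>u\<in>carr X. \<bar>f u\<bar> \<le> C * nrm X u)}"

text \<open>\<^const>\<open>Sup\<close> on the reals: this is the dual norm when \<open>f \<in> dual X\<close> and \<open>X\<close> is not the
  zero space.\<close>

definition dual_norm :: "'a normed_sp \<Rightarrow> ('a \<Rightarrow> real) \<Rightarrow> real" where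
  "dual_norm X f = (SUP v\<in>carr X - {zer X}. f v / nrm X v)"

text \<open>The adjoint of \<open>T\<close>, where \<open>T\<close> is defined on the carrier of \<open>X\<close>.\<close>

definition adj :: "'a normed_sp \<Rightarrow> ('a \<Rightarrow> 'b) \<Rightarrow> ('b \<Rightarrow> real) \<Rightarrow> 'a \<Rightarrow> real" where
  "adj X T g = (\<lambda>x\<in>carr X. g (T x))"

definition extensions :: "'a normed_sp \<Rightarrow> 'a set \<Rightarrow> ('a \<Rightarrow> real) \<Rightarrow> ('a \<Rightarrow> real) set" where
  "extensions X A r = {r' \<in> dual X. \<forall>a\<in>A. r' a = r a}"


section \<open>Partial derivatives and test functions\<close>

definition pderiv_dir :: "'d::finite \<Rightarrow> (real^'d \<Rightarrow> real) \<Rightarrow> real^'d \<Rightarrow> real" where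
  "pderiv_dir i f = (\<lambda>x. deriv (\<lambda>t. f (x + t *\<^sub>R axis i 1)) 0)"

definition smooth :: "(real^'d::finite \<Rightarrow> real) \<Rightarrow> bool" where
  "smooth f \<longleftrightarrow> (\<forall>is. continuous_on UNIV (foldr pderiv_dir is f) \<and>
     (\<forall>i x. (\<lambda>t. foldr pderiv_dir is f (x + t *\<^sub>R axis i 1)) differentiable at 0))"

text \<open>Multi-indices are functions \<open>'d \<Rightarrow> nat\<close>. The index type is not ordered, so the order in which
  the partial derivatives are taken is chosen arbitrarily; it is irrelevant for smooth functions,
  the only ones to which this is applied.\<close>

definition mi_order :: "('d::finite \<Rightarrow> nat) \<Rightarrow> nat" where
  "mi_order \<alpha> = (\<Sum>i\<in>UNIV. \<alpha> i)"

definition mderiv :: "('d::finite \<Rightarrow> nat) \<Rightarrow> (real^'d \<Rightarrow> real) \<Rightarrow> real^'d \<Rightarrow> real" where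
  "mderiv \<alpha> f = foldr pderiv_dir (SOME is. count_list is = \<alpha>) f"

text \<open>A function in \<open>C\<^sub>c\<^sup>\<infinity>(G)\<close> is represented by its extension by zero to the whole space.\<close>

definition test_funs :: "(real^'d::finite) set \<Rightarrow> (real^'d \<Rightarrow> real) set" where
  "test_funs G = {\<phi>. smooth \<phi> \<and> compact (closure {x. \<phi> x \<noteq> 0}) \<and> closure {x. \<phi> x \<noteq> 0} \<subseteq> G}"


section \<open>Square-integrable functions modulo equality almost everywhere\<close>

text \<open>An element of \<open>L\<^sub>2(G)\<close> is an equivalence class of functions. As the functions have type
  \<open>real^'d \<Rightarrow> real\<close>, the class leaves their values outside \<open>G\<close> arbitrary.\<close>

type_synonym 'd fclass = "(real^'d \<Rightarrow> real) set"

definition sq_integrable :: "(real^'d::finite) set \<Rightarrow> (real^'d \<Rightarrow> real) set" where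
  "sq_integrable G = {f \<in> borel_measurable (lebesgue_on G). integrable (lebesgue_on G) (\<lambda>x. (f x)\<^sup>2)}"

definition ae_eq :: "(real^'d::finite) set \<Rightarrow> ((real^'d \<Rightarrow> real) \<times> (real^'d \<Rightarrow> real)) set" where
  "ae_eq G = {(f, g). f \<in> sq_integrable G \<and> g \<in> sq_integrable G \<and> (AE x in lebesgue_on G. f x = g x)}"

definition cls :: "(real^'d::finite) set \<Rightarrow> (real^'d \<Rightarrow> real) \<Rightarrow> 'd fclass" where
  "cls G f = ae_eq G `` {f}"

definition rep :: "'d::finite fclass \<Rightarrow> real^'d \<Rightarrow> real" where
  "rep u = (SOME f. f \<in> u)"

definition L2 :: "(real^'d::finite) set \<Rightarrow> 'd fclass set" where
  "L2 G = sq_integrable G // ae_eq G"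

definition L2_norm :: "(real^'d::finite) set \<Rightarrow> 'd fclass \<Rightarrow> real" where
  "L2_norm G u = sqrt (\<integral>x. (rep u x)\<^sup>2 \<partial>lebesgue_on G)"


section \<open>Sobolev spaces\<close>

definition is_weak_deriv ::
  "(real^'d::finite) set \<Rightarrow> ('d \<Rightarrow> nat) \<Rightarrow> 'd fclass \<Rightarrow> 'd fclass \<Rightarrow> bool" where
  "is_weak_deriv G \<alpha> u w \<longleftrightarrow> w \<in> L2 G \<and>
     (\<forall>\<phi>\<in>test_funs G. (\<integral>x. rep u x * mderiv \<alpha> \<phi> x \<partial>lebesgue_on G) =
        (-1) ^ mi_order \<alpha> * (\<integral>x. rep w x * \<phi> x \<partial>lebesgue_on G))"

definition weak_deriv :: "(real^'d::finite) set \<Rightarrow> ('d \<Rightarrow> nat) \<Rightarrow> 'd fclass \<Rightarrow> 'd fclass" where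
  "weak_deriv G \<alpha> u = (THE w. is_weak_deriv G \<alpha> u w)"

definition Sob :: "nat \<Rightarrow> (real^'d::finite) set \<Rightarrow> 'd fclass normed_sp" where
  "Sob m G = \<lparr>
     carr = {u \<in> L2 G. \<forall>\<alpha>. mi_order \<alpha> \<le> m \<longrightarrow> (\<exists>w. is_weak_deriv G \<alpha> u w)},
     add = (\<lambda>u v. cls G (\<lambda>x. rep u x + rep v x)),
     scl = (\<lambda>c u. cls G (\<lambda>x. c * rep u x)),
     zer = cls G (\<lambda>x. 0),
     nrm = (\<lambda>u. sqrt (\<Sum>\<alpha> | mi_order \<alpha> \<le> m. (L2_norm G (weak_deriv G \<alpha> u))\<^sup>2))\<rparr>"

definition Sob0 :: "nat \<Rightarrow> (real^'d::finite) set \<Rightarrow> 'd fclass normed_sp" where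
  "Sob0 m G = subsp (Sob m G) (norm_closure (Sob m G) (cls G ` test_funs G))"

definition zero_ext :: "(real^'d::finite) set \<Rightarrow> (real^'d) set \<Rightarrow> 'd fclass \<Rightarrow> 'd fclass" where
  "zero_ext G\<^sub>1 G\<^sub>2 u = cls G\<^sub>2 (\<lambda>x. if x \<in> G\<^sub>1 then rep u x else 0)"

definition domain :: "(real^'d::finite) set \<Rightarrow> bool" where
  "domain G \<longleftrightarrow> open G \<and> connected G \<and> G \<noteq> {}"

end

theory Submission
  imports Defs
begin

text \<open>Extension by zero is a linear isometry of \<open>H\<^sub>0\<^sup>m\<close> of the smaller domain into that of the larger
  one, so each supremum that defines a dual norm is taken over a subset of the quotients on the larger
  domain. The isometry holds because the zero extension of a weak derivative is a weak derivative of the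
  zero extension: both sides of the defining identity pass to the limit along test functions of the
  smaller domain, which are test functions of the larger one. Since norms are computed from weak
  derivatives chosen by \<^const>\<open>The\<close>, this needs their uniqueness, that is, the fundamental lemma of
  the calculus of variations.\<close>


section \<open>Smooth bump functions\<close>

text \<open>Two obstacles shape the proof. One is the supply of test functions: they are needed for
  the fundamental lemma, and also to know that H_0^m(G) is not the zero space, since otherwise the
  real supremum in \<open>dual_norm\<close> runs over the empty set. Smooth bumps on boxes serve
  both purposes. As they sharpen to the indicator of the box, a function orthogonal to all test
  functions has integral 0 over every box, and averages over small cubes then take the place of
  mollification. The other obstacle is that \<open>mderiv\<close> takes the partial derivatives in
  an unspecified order, whereas integration by parts reverses whatever order was chosen. A test
  function is therefore paired with its derivatives in the reversed order, and it is these that pass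
  to the limit and become weak derivatives.\<close>

definition exp_inv_poly :: "real poly \<Rightarrow> real \<Rightarrow> real" where
  "exp_inv_poly p t = (if t \<le> 0 then 0 else poly p (1 / t) * exp (- (1 / t)))"

lemma poly_over_exp_tendsto_0: "((\<lambda>s. poly p s * exp (- s)) \<longlongrightarrow> 0) (at_top :: real filter)"
proof -
  have "((\<lambda>s. \<Sum>i\<le>degree p. coeff p i * (s ^ i / exp s)) \<longlongrightarrow> (\<Sum>i\<le>degree p. coeff p i * 0))
          (at_top :: real filter)"
    by (intro tendsto_sum tendsto_mult tendsto_const tendsto_power_div_exp_0)
  then show ?thesis
    by (simp add: poly_altdef exp_minus divide_inverse sum_distrib_right mult.assoc)
qed

text \<open>This is the difference quotient at the origin, where the value is 0. From the right, s =
  1/t turns it into a polynomial in s times exp (- s); the factor 1/t raises the polynomial to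
  \<open>pCons 0 p\<close>.\<close>

lemma exp_inv_poly_div_tendsto_0: "((\<lambda>t. exp_inv_poly p t / t) \<longlongrightarrow> 0) (at 0)"
proof (rule filterlim_split_at)
  show "((\<lambda>t. exp_inv_poly p t / t) \<longlongrightarrow> 0) (at_left 0)"
    by (rule tendsto_eventually)
      (auto simp: exp_inv_poly_def eventually_at intro!: exI[of _ 1])
  have "((\<lambda>t. poly (pCons 0 p) (inverse t) * exp (- inverse t)) \<longlongrightarrow> 0) (at_right (0::real))"
    by (rule filterlim_compose[OF poly_over_exp_tendsto_0 filterlim_inverse_at_top_right])
  moreover have "\<forall>\<^sub>F t in at_right (0::real).
      poly (pCons 0 p) (inverse t) * exp (- inverse t) = exp_inv_poly p t / t"
    by (auto simp: exp_inv_poly_def eventually_at divide_inverse intro!: exI[of _ 1])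
  ultimately show "((\<lambda>t. exp_inv_poly p t / t) \<longlongrightarrow> 0) (at_right 0)"
    by (rule Lim_transform_eventually)
qed

text \<open>With s = 1/t, the s-derivative of p(s) exp (- s) is (p' - p)(s) exp (- s), and ds/dt = -
  s^2. The product has the same form with the polynomial s^2 (p - p'), so carrying a polynomial
  closes the family under differentiation.\<close>

lemma exp_inv_poly_deriv:
  "(exp_inv_poly p has_field_derivative exp_inv_poly (monom 1 2 * (p - pderiv p)) t) (at t)"
proof (cases t "0::real" rule: linorder_cases)
  case less
  have "((\<lambda>t. 0) has_field_derivative 0) (at t)"
    by simp
  then have "(exp_inv_poly p has_field_derivative 0) (at t)"
    by (rule has_field_derivative_transform_within_open[where S = "{..<0}"])
      (use less in \<open>auto simp: exp_inv_poly_def\<close>)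
  then show ?thesis
    using less by (simp add: exp_inv_poly_def)
next
  case equal
  then show ?thesis
    using exp_inv_poly_div_tendsto_0[of p]
    by (simp add: has_field_derivative_iff) (simp add: exp_inv_poly_def)
next
  case greater
  have "((\<lambda>t. poly p (1 / t) * exp (- (1 / t))) has_field_derivative
      poly (pderiv p) (1 / t) * (- 1 / t\<^sup>2) * exp (- (1 / t)) +
      poly p (1 / t) * (exp (- (1 / t)) * (1 / t\<^sup>2))) (at t)"
    using greater
    by (auto intro!: derivative_eq_intros poly_DERIV[THEN DERIV_chain2]
        simp: power2_eq_square field_simps)
  then have "((\<lambda>t. poly p (1 / t) * exp (- (1 / t))) has_field_derivative
      exp_inv_poly (monom 1 2 * (p - pderiv p)) t) (at t)"
    by (rule DERIV_cong)
      (use greater in \<open>simp add: exp_inv_poly_def poly_monom power2_eq_square field_simps\<close>)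
  then show ?thesis
    by (rule has_field_derivative_transform_within_open[where S = "{0<..}"])
      (use greater in \<open>auto simp: exp_inv_poly_def\<close>)
qed

text \<open>An algebra of functions that contains the bump functions and is closed under partial
  derivatives; the latter is what makes its members smooth.\<close>

inductive bump_algebra :: "(real^'d::finite \<Rightarrow> real) \<Rightarrow> bool" where
  exp_inv: "bump_algebra (\<lambda>x. exp_inv_poly p (c * x $ i + b))"
| const: "bump_algebra (\<lambda>x. c)"
| add: "bump_algebra f \<Longrightarrow> bump_algebra g \<Longrightarrow> bump_algebra (\<lambda>x. f x + g x)"
| mult: "bump_algebra f \<Longrightarrow> bump_algebra g \<Longrightarrow> bump_algebra (\<lambda>x. f x * g x)"

lemma bump_algebra_continuous:
  "bump_algebra f \<Longrightarrow> continuous_on UNIV f"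
proof (induction rule: bump_algebra.induct)
  case (exp_inv p c i b)
  have "continuous_on UNIV (exp_inv_poly p)"
    using exp_inv_poly_deriv DERIV_isCont by (blast intro: continuous_at_imp_continuous_on)
  then show ?case
    by (rule continuous_on_compose2) (auto intro!: continuous_intros)
qed (auto intro!: continuous_intros)

lemma bump_algebra_deriv:
  "bump_algebra f \<Longrightarrow> \<exists>f'. bump_algebra f' \<and>
     (\<forall>x. ((\<lambda>t. f (x + t *\<^sub>R axis j 1)) has_field_derivative f' x) (at 0))"
proof (induction rule: bump_algebra.induct)
  case (exp_inv p c i b)
  \<comment> \<open>Moving in direction j changes only the coordinate j, so the affine argument has
    slope c or 0.\<close>
  let ?\<delta> = "if i = j then c else 0"
  let ?q = "monom 1 2 * (p - pderiv p)"
  have "((\<lambda>t. exp_inv_poly p (c * (x + t *\<^sub>R axis j 1) $ i + b)) has_field_derivative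
      exp_inv_poly ?q (c * x $ i + b) * ?\<delta>) (at 0)" for x
  proof -
    have "(exp_inv_poly p has_field_derivative exp_inv_poly ?q (c * x $ i + b))
        (at (c * (x + 0 *\<^sub>R axis j 1) $ i + b))"
      using exp_inv_poly_deriv[of p "c * x $ i + b"] by simp
    then show ?thesis
      by (rule DERIV_chain2) (auto intro!: derivative_eq_intros simp: axis_def)
  qed
  then show ?case
    by (intro exI[of _ "\<lambda>x. exp_inv_poly ?q (c * x $ i + b) * ?\<delta>"])
      (auto intro: bump_algebra.intros)
next
  case (const c)
  show ?case
    by (rule exI[of _ "\<lambda>x. 0"]) (auto intro: bump_algebra.intros)
next
  case (add f g)
  then obtain f' g' where "bump_algebra f'" "bump_algebra g'"
    "\<And>x. ((\<lambda>t. f (x + t *\<^sub>R axis j 1)) has_field_derivative f' x) (at 0)"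
    "\<And>x. ((\<lambda>t. g (x + t *\<^sub>R axis j 1)) has_field_derivative g' x) (at 0)"
    by blast
  then show ?case
    by (intro exI[of _ "\<lambda>x. f' x + g' x"]) (auto intro: bump_algebra.intros DERIV_add)
next
  case (mult f g)
  then obtain f' g' where "bump_algebra f'" "bump_algebra g'"
    and "\<And>x. ((\<lambda>t. f (x + t *\<^sub>R axis j 1)) has_field_derivative f' x) (at 0)"
    "\<And>x. ((\<lambda>t. g (x + t *\<^sub>R axis j 1)) has_field_derivative g' x) (at 0)"
    by blast
  moreover from this have "((\<lambda>t. f (x + t *\<^sub>R axis j 1) * g (x + t *\<^sub>R axis j 1))
      has_field_derivative f' x * g x + g' x * f x) (at 0)" for x
    using DERIV_mult[of "\<lambda>t. f (x + t *\<^sub>R axis j 1)" "f' x" 0 UNIV "\<lambda>t. g (x + t *\<^sub>R axis j 1)" "g' x"]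
    by simp
  ultimately show ?case
    using mult.hyps by (intro exI[of _ "\<lambda>x. f' x * g x + g' x * f x"]) (auto intro: bump_algebra.intros)
qed

lemma bump_algebra_pderiv_dir:
  assumes "bump_algebra f"
  shows "bump_algebra (pderiv_dir j f)"
proof -
  obtain f' where f': "bump_algebra f'"
    "\<And>x. ((\<lambda>t. f (x + t *\<^sub>R axis j 1)) has_field_derivative f' x) (at 0)"
    using bump_algebra_deriv[OF assms] by blast
  then have "pderiv_dir j f = f'"
    unfolding pderiv_dir_def by (auto intro: DERIV_imp_deriv)
  then show ?thesis
    using f'(1) by simp
qed

lemma bump_algebra_smooth:
  assumes "bump_algebra f"
  shows "smooth f"
proof -
  have *: "bump_algebra (foldr pderiv_dir is f)" for "is"
    by (induction "is") (auto intro: bump_algebra_pderiv_dir assms)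
  show ?thesis
    unfolding smooth_def
  proof (intro allI conjI)
    fix "is" :: "'a list" and i x
    show "continuous_on UNIV (foldr pderiv_dir is f)"
      by (rule bump_algebra_continuous[OF *])
    show "(\<lambda>t. foldr pderiv_dir is f (x + t *\<^sub>R axis i 1)) differentiable at 0"
      using bump_algebra_deriv[OF *[of "is"], of i] real_differentiable_def by blast
  qed
qed

lemma bump_algebra_prod:
  assumes "finite I" "\<And>i. i \<in> I \<Longrightarrow> bump_algebra (f i)"
  shows "bump_algebra (\<lambda>x. \<Prod>i\<in>I. f i x)"
  using assms by (induction I) (auto intro: bump_algebra.intros)

text \<open>In each coordinate one factor exp (- 1/t) vanishes at the lower face and one at the
  upper face. The scale c > 0 leaves the support unchanged; letting it grow sharpens the bump to the
  indicator of the open box.\<close>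

definition box_bump :: "real \<Rightarrow> real^'d::finite \<Rightarrow> real^'d \<Rightarrow> real^'d \<Rightarrow> real" where
  "box_bump c a b x = (\<Prod>i\<in>UNIV. exp_inv_poly 1 (c * (x $ i - a $ i)) * exp_inv_poly 1 (c * (b $ i - x $ i)))"

lemma exp_inv_poly_1_bounds: "0 \<le> exp_inv_poly 1 t" "exp_inv_poly 1 t \<le> 1"
  "0 < exp_inv_poly 1 t \<longleftrightarrow> 0 < t"
  by (auto simp: exp_inv_poly_def)

lemma box_bump_bounds: "0 \<le> box_bump c a b x" "box_bump c a b x \<le> 1"
  unfolding box_bump_def
  by (auto intro!: prod_nonneg prod_le_1 mult_nonneg_nonneg mult_le_one simp: exp_inv_poly_1_bounds)

lemma box_bump_pos_iff:
  assumes "c > 0"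
  shows "0 < box_bump c a b x \<longleftrightarrow> x \<in> box a b"
proof -
  have "0 < box_bump c a b x \<longleftrightarrow> box_bump c a b x \<noteq> 0"
    using box_bump_bounds(1)[of c a b x] by linarith
  also have "\<dots> \<longleftrightarrow> (\<forall>i. exp_inv_poly 1 (c * (x $ i - a $ i)) > 0 \<and> exp_inv_poly 1 (c * (b $ i - x $ i)) > 0)"
    using exp_inv_poly_1_bounds(1) by (auto simp: box_bump_def less_le)
  also have "\<dots> \<longleftrightarrow> x \<in> box a b"
    using assms by (auto simp: exp_inv_poly_1_bounds mem_box_cart zero_less_mult_iff)
  finally show ?thesis .
qed

lemma box_bump_test_fun:
  assumes "c > 0" "cbox a b \<subseteq> G"
  shows "box_bump c a b \<in> test_funs G"
proof -
  have "bump_algebra (box_bump c a b)"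
  proof -
    \<comment> \<open>Both factors are brought to the affine form of the generators; the one for the
      upper face has slope - c.\<close>
    have "box_bump c a b = (\<lambda>x. \<Prod>i\<in>UNIV.
        exp_inv_poly 1 (c * x $ i + - c * a $ i) * exp_inv_poly 1 (- c * x $ i + c * b $ i))"
      by (auto simp: box_bump_def fun_eq_iff algebra_simps)
    then show ?thesis
      by (simp only:) (intro bump_algebra_prod bump_algebra.mult bump_algebra.exp_inv finite)
  qed
  moreover have "closure {x. box_bump c a b x \<noteq> 0} \<subseteq> cbox a b"
  proof (rule closure_minimal)
    show "{x. box_bump c a b x \<noteq> 0} \<subseteq> cbox a b"
      using box_bump_pos_iff[OF \<open>c > 0\<close>, of a b] box_bump_bounds(1)[of c a b] box_subset_cbox[of a b]
      by (force simp: less_le)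
  qed (rule closed_cbox)
  moreover from this have "compact (closure {x. box_bump c a b x \<noteq> 0})"
    using compact_cbox compact_Int_closed[of "cbox a b" "closure {x. box_bump c a b x \<noteq> 0}"]
    by (auto simp: Int_absorb1)
  ultimately show ?thesis
    using assms(2) bump_algebra_smooth by (auto simp: test_funs_def)
qed

text \<open>For t > 0 the value is exp (- 1 / ((n + 1) t)). The index \<open>Suc n\<close> keeps the
  scale positive from the start, as \<open>box_bump_test_fun\<close> requires.\<close>

lemma exp_inv_poly_1_tendsto:
  "(\<lambda>n. exp_inv_poly 1 (real (Suc n) * t)) \<longlonglongrightarrow> (if t > 0 then 1 else 0)"
proof (cases "t > 0")
  case True
  have "(\<lambda>n. exp (- (1 / t * inverse (real (Suc n))))) \<longlonglongrightarrow> exp (- (1 / t * 0))"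
    by (intro tendsto_intros LIMSEQ_inverse_real_of_nat)
  moreover have "exp (- (1 / t * inverse (real (Suc n)))) = exp_inv_poly 1 (real (Suc n) * t)" for n
  proof -
    have "\<not> real (Suc n) * t \<le> 0"
      using True mult_pos_pos[of "real (Suc n)" t] by linarith
    then show ?thesis
      by (simp add: exp_inv_poly_def divide_inverse mult.commute del: of_nat_Suc)
  qed
  ultimately show ?thesis
    using True by simp
next
  case False
  then have "exp_inv_poly 1 (real (Suc n) * t) = 0" for n
    using mult_nonneg_nonpos[of "real (Suc n)" t] by (simp add: exp_inv_poly_def del: of_nat_Suc)
  then show ?thesis
    using False by simp
qed

lemma box_bump_tendsto: "(\<lambda>n. box_bump (real (Suc n)) a b x) \<longlonglongrightarrow> indicator (box a b) x"
proof -
  let ?\<chi> = "\<lambda>t::real. if t > 0 then 1 else 0 :: real"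
  have "(\<lambda>n. box_bump (real (Suc n)) a b x) \<longlonglongrightarrow> (\<Prod>i\<in>UNIV. ?\<chi> (x $ i - a $ i) * ?\<chi> (b $ i - x $ i))"
    unfolding box_bump_def by (intro tendsto_prod tendsto_mult exp_inv_poly_1_tendsto)
  also have "(\<Prod>i\<in>UNIV. ?\<chi> (x $ i - a $ i) * ?\<chi> (b $ i - x $ i)) = indicator (box a b) x"
  proof (cases "x \<in> box a b")
    case False
    then obtain i where "\<not> a $ i < x $ i \<or> \<not> x $ i < b $ i"
      by (auto simp: mem_box_cart)
    then have "(\<Prod>i\<in>UNIV. ?\<chi> (x $ i - a $ i) * ?\<chi> (b $ i - x $ i)) = 0"
      by (intro prod_zero) auto
    then show ?thesis
      using False by simp
  qed (auto simp: mem_box_cart)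
  finally show ?thesis .
qed


section \<open>Test functions\<close>

lemma smooth_foldr: "smooth f \<Longrightarrow> smooth (foldr pderiv_dir is f)"
  unfolding smooth_def by (metis foldr_append comp_apply)

lemma smooth_continuous: "smooth f \<Longrightarrow> continuous_on UNIV f"
  unfolding smooth_def by (metis foldr_Nil id_apply)

text \<open>\<open>smooth\<close> speaks of differentiability at parameter 0 only, but from every
  base point; moving the base point to x + s e_i gives the derivative along the whole line.\<close>

lemma smooth_deriv:
  assumes "smooth f"
  shows "((\<lambda>t. f (x + t *\<^sub>R axis i 1)) has_field_derivative pderiv_dir i f (x + s *\<^sub>R axis i 1)) (at s)"
proof -
  have "(\<lambda>t. foldr pderiv_dir [] f (y + t *\<^sub>R axis i 1)) differentiable at 0" for y
    using assms unfolding smooth_def by blast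
  then have "((\<lambda>t. f (y + t *\<^sub>R axis i 1)) has_field_derivative pderiv_dir i f y) (at 0)" for y
    by (simp add: pderiv_dir_def DERIV_deriv_iff_real_differentiable)
  from this[of "x + s *\<^sub>R axis i 1"]
  have "((\<lambda>t. f (x + (t + s) *\<^sub>R axis i 1)) has_field_derivative pderiv_dir i f (x + s *\<^sub>R axis i 1)) (at 0)"
    by (simp add: algebra_simps)
  then show ?thesis
    using DERIV_at_within_shift[of "\<lambda>t. f (x + t *\<^sub>R axis i 1)" "pderiv_dir i f (x + s *\<^sub>R axis i 1)" s 0 UNIV]
    by (simp add: add.commute)
qed

text \<open>Off the closed support f vanishes on an open set, hence on a short segment in direction
  i, where the derivative is 0.\<close>

lemma pderiv_dir_support:
  "closure {x. pderiv_dir i f x \<noteq> 0} \<subseteq> closure {x. f x \<noteq> 0}"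
proof (rule closure_minimal)
  show "{x. pderiv_dir i f x \<noteq> 0} \<subseteq> closure {x. f x \<noteq> 0}"
  proof (rule subsetI, rule ccontr)
    fix x
    assume x: "x \<in> {x. pderiv_dir i f x \<noteq> 0}" "x \<notin> closure {x. f x \<noteq> 0}"
    let ?U = "- closure {x. f x \<noteq> 0}"
    have "open ((\<lambda>t. x + t *\<^sub>R axis i 1) -` ?U)"
      by (intro continuous_open_vimage) (auto intro!: continuous_intros)
    then have "((\<lambda>t. f (x + t *\<^sub>R axis i 1)) has_field_derivative 0) (at 0)"
      by (rule has_field_derivative_transform_within_open[where f = "\<lambda>_. 0"
            and g = "\<lambda>t. f (x + t *\<^sub>R axis i 1)" and a = 0, OF DERIV_const])
        (use x closure_subset[of "{x. f x \<noteq> 0}"] in auto)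
    then have "pderiv_dir i f x = 0"
      unfolding pderiv_dir_def by (rule DERIV_imp_deriv)
    then show False
      using x by simp
  qed
qed simp

lemma test_funs_smooth: "\<phi> \<in> test_funs G \<Longrightarrow> smooth \<phi>"
  and test_funs_continuous: "\<phi> \<in> test_funs G \<Longrightarrow> continuous_on UNIV \<phi>"
  and test_funs_mono: "G \<subseteq> G' \<Longrightarrow> test_funs G \<subseteq> test_funs G'"
  by (auto simp: test_funs_def smooth_continuous)

lemma test_funs_support:
  assumes "\<phi> \<in> test_funs G"
  obtains K where "compact K" "K \<subseteq> G" "\<And>x. x \<notin> K \<Longrightarrow> \<phi> x = 0"
proof
  show "compact (closure {x. \<phi> x \<noteq> 0})" "closure {x. \<phi> x \<noteq> 0} \<subseteq> G"
    using assms by (auto simp: test_funs_def)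
  show "\<phi> x = 0" if "x \<notin> closure {x. \<phi> x \<noteq> 0}" for x
    using that closure_subset[of "{x. \<phi> x \<noteq> 0}"] by auto
qed

lemma test_funs_zero_outside: "\<phi> \<in> test_funs G \<Longrightarrow> x \<notin> G \<Longrightarrow> \<phi> x = 0"
  using test_funs_support by (metis subsetD)

lemma test_funs_pderiv_dir:
  assumes "\<phi> \<in> test_funs G"
  shows "pderiv_dir i \<phi> \<in> test_funs G"
proof -
  have "smooth (pderiv_dir i \<phi>)"
    using smooth_foldr[of \<phi> "[i]"] assms by (simp add: test_funs_def)
  moreover have "compact (closure {x. pderiv_dir i \<phi> x \<noteq> 0})"
    using pderiv_dir_support[of i \<phi>] assms
    by (metis (mono_tags, lifting) closed_closure compact_Int_closed inf.absorb2 mem_Collect_eq test_funs_def)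
  ultimately show ?thesis
    using pderiv_dir_support[of i \<phi>] assms by (auto simp: test_funs_def)
qed

lemma test_funs_foldr: "\<phi> \<in> test_funs G \<Longrightarrow> foldr pderiv_dir is \<phi> \<in> test_funs G"
  by (induction "is") (auto intro: test_funs_pderiv_dir)

lemma test_funs_zero: "(\<lambda>x. 0) \<in> test_funs G"
  by (simp add: test_funs_def bump_algebra_smooth bump_algebra.const)

lemma test_funs_measurable: "\<phi> \<in> test_funs G \<Longrightarrow> \<phi> \<in> borel_measurable borel"
  by (rule borel_measurable_continuous_onI[OF test_funs_continuous])

lemma compact_support_integrable:
  fixes f :: "'a::euclidean_space \<Rightarrow> real"
  assumes "compact K" "continuous_on UNIV f" "\<And>x. x \<notin> K \<Longrightarrow> f x = 0"
  shows "integrable lborel f"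
proof -
  have "integrable lborel (\<lambda>x. indicator K x *\<^sub>R f x)"
    using continuous_on_subset[OF assms(2)] by (intro borel_integrable_compact assms(1)) simp
  moreover have "(\<lambda>x. indicator K x *\<^sub>R f x) = f"
    using assms(3) by (auto simp: indicator_def fun_eq_iff)
  ultimately show ?thesis
    by simp
qed


section \<open>Square-integrable functions\<close>

lemma sq_integrableD:
  "f \<in> sq_integrable G \<Longrightarrow> f \<in> borel_measurable (lebesgue_on G)"
  "f \<in> sq_integrable G \<Longrightarrow> integrable (lebesgue_on G) (\<lambda>x. (f x)\<^sup>2)"
  by (auto simp: sq_integrable_def)

lemma sq_integrable_mult:
  assumes "f \<in> sq_integrable G" "g \<in> sq_integrable G"
  shows "integrable (lebesgue_on G) (\<lambda>x. f x * g x)"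
proof (rule Bochner_Integration.integrable_bound)
  show "integrable (lebesgue_on G) (\<lambda>x. (f x)\<^sup>2 + (g x)\<^sup>2)"
    using assms by (auto dest: sq_integrableD)
  show "(\<lambda>x. f x * g x) \<in> borel_measurable (lebesgue_on G)"
    using assms by (intro borel_measurable_times sq_integrableD(1))
  have "\<bar>a * b\<bar> \<le> a\<^sup>2 + b\<^sup>2" for a b :: real
  proof -
    have "2 * (\<bar>a\<bar> * \<bar>b\<bar>) \<le> a\<^sup>2 + b\<^sup>2"
      using sum_squares_bound[of "\<bar>a\<bar>" "\<bar>b\<bar>"] by (simp add: mult.assoc)
    moreover have "0 \<le> \<bar>a\<bar> * \<bar>b\<bar>"
      by simp
    ultimately show ?thesis
      unfolding abs_mult by linarith
  qed
  then show "AE x in lebesgue_on G. norm (f x * g x) \<le> norm ((f x)\<^sup>2 + (g x)\<^sup>2)"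
    by simp
qed

lemma sq_integrable_scale: "f \<in> sq_integrable G \<Longrightarrow> (\<lambda>x. c * f x) \<in> sq_integrable G"
  by (auto simp: sq_integrable_def power_mult_distrib)

lemma sq_integrable_add:
  assumes "f \<in> sq_integrable G" "g \<in> sq_integrable G"
  shows "(\<lambda>x. f x + g x) \<in> sq_integrable G"
proof -
  have "integrable (lebesgue_on G) (\<lambda>x. (f x)\<^sup>2 + (g x)\<^sup>2 + 2 * (f x * g x))"
    using assms sq_integrable_mult by (intro Bochner_Integration.integrable_add) (auto dest: sq_integrableD)
  then show ?thesis
    using assms by (auto simp: sq_integrable_def power2_sum mult.assoc)
qed

lemma sq_integrable_diff:
  assumes "f \<in> sq_integrable G" "g \<in> sq_integrable G"
  shows "(\<lambda>x. f x - g x) \<in> sq_integrable G"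
  using sq_integrable_add[OF assms(1) sq_integrable_scale[OF assms(2), of "-1"]] by simp

text \<open>Links the two measures in use: continuous functions are integrated against
  \<open>lborel\<close>, while the function spaces live over the completed measure restricted to
  G.\<close>

lemma integrable_lebesgue_on:
  fixes f :: "real^'d::finite \<Rightarrow> real"
  assumes "open G" "integrable lborel f"
  shows "integrable (lebesgue_on G) f"
proof -
  have "integrable lebesgue f"
    using assms(2) borel_measurable_integrable integrable_completion by blast
  then have "integrable lebesgue (\<lambda>x. indicator G x *\<^sub>R f x)"
    using assms(1) by (intro integrable_mult_indicator) auto
  then show ?thesis
    using assms(1) by (simp add: integrable_restrict_space)
qed

lemma borel_measurable_lebesgue_on:
  "f \<in> borel_measurable borel \<Longrightarrow> f \<in> borel_measurable (lebesgue_on G)"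
  by (simp add: measurable_completion measurable_restrict_space1)

lemma test_funs_sq_integrable:
  assumes "\<phi> \<in> test_funs G'" "open G"
  shows "\<phi> \<in> sq_integrable G"
proof -
  obtain K where K: "compact K" "\<And>x. x \<notin> K \<Longrightarrow> \<phi> x = 0"
    using test_funs_support[OF assms(1)] by metis
  have "integrable lborel (\<lambda>x. (\<phi> x)\<^sup>2)"
    using K(2)
    by (intro compact_support_integrable[OF K(1)] continuous_on_power test_funs_continuous[OF assms(1)]) simp
  then have "integrable (lebesgue_on G) (\<lambda>x. (\<phi> x)\<^sup>2)"
    by (rule integrable_lebesgue_on[OF assms(2)])
  then show ?thesis
    using borel_measurable_lebesgue_on[OF test_funs_measurable[OF assms(1)]]
    by (simp add: sq_integrable_def)
qed

lemma integral_lebesgue_on_open: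
  fixes f :: "real^'d::finite \<Rightarrow> real"
  assumes "open G" "\<And>x. x \<notin> G \<Longrightarrow> f x = 0"
  shows "(\<integral>x. f x \<partial>lebesgue_on G) = (\<integral>x. f x \<partial>lebesgue)"
proof -
  have "(\<integral>x. f x \<partial>lebesgue_on G) = (\<integral>x. indicator G x *\<^sub>R f x \<partial>lebesgue)"
    using assms(1) by (simp add: integral_restrict_space)
  also have "(\<lambda>x. indicator G x *\<^sub>R f x) = f"
    using assms(2) by (auto simp: indicator_def fun_eq_iff)
  finally show ?thesis .
qed


section \<open>The fundamental lemma of the calculus of variations\<close>

text \<open>Bumps tending to the indicator of a smaller box show that g has integral 0 over every
  box inside \<open>cbox c d\<close>; by Lebesgue differentiation g is almost everywhere the limit
  of such averages.\<close>

lemma fundamental_lemma_box: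
  fixes g :: "real^'d::finite \<Rightarrow> real"
  assumes "open G" and g: "g \<in> sq_integrable G"
    and zero: "\<And>\<phi>. \<phi> \<in> test_funs G \<Longrightarrow> (\<integral>x. g x * \<phi> x \<partial>lebesgue_on G) = 0"
    and cd: "cbox c d \<subseteq> G"
  shows "\<exists>N. negligible N \<and> (\<forall>x\<in>cbox c d - N. g x = 0)"
proof -
  define F where "F x = indicator (cbox c d) x * g x" for x
  \<comment> \<open>Products of square-integrable functions are integrable, so cutting g off to a
    bounded box makes it integrable.\<close>
  have "(indicator (cbox c d) :: _ \<Rightarrow> real) \<in> sq_integrable G"
  proof -
    have "integrable lborel (\<lambda>x. (indicator (cbox c d) x :: real)\<^sup>2)"
      using borel_integrable_compact[OF compact_cbox, of c d "\<lambda>_. 1 :: real"]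
      by (simp add: power2_eq_square indicator_inter_arith[symmetric])
    then show ?thesis
      using \<open>open G\<close> by (auto simp: sq_integrable_def intro!: integrable_lebesgue_on borel_measurable_lebesgue_on)
  qed
  then have "integrable (lebesgue_on G) F"
    unfolding F_def using g by (rule sq_integrable_mult)
  then have "integrable lebesgue (\<lambda>x. indicator G x *\<^sub>R F x)"
    using \<open>open G\<close> by (simp add: integrable_restrict_space)
  moreover have "(\<lambda>x. indicator G x *\<^sub>R F x) = F"
    using cd by (auto simp: F_def indicator_def fun_eq_iff)
  ultimately have F: "integrable lebesgue F"
    by simp
  have zero_box: "integral (cbox a b) F = 0" if ab: "cbox a b \<subseteq> cbox c d" for a b
  proof -
    let ?\<phi> = "\<lambda>n. box_bump (real (Suc n)) a b"
    \<comment> \<open>The first membership admits the bump in the hypothesis on g; the second makes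
      it vanish where F and g may differ.\<close>
    have \<phi>: "?\<phi> n \<in> test_funs G" "?\<phi> n \<in> test_funs (cbox c d)" for n
      using ab cd by (auto intro!: box_bump_test_fun)
    have "(\<lambda>n. \<integral>x. F x * ?\<phi> n x \<partial>lebesgue) \<longlonglongrightarrow> (\<integral>x. F x * indicator (box a b) x \<partial>lebesgue)"
    proof (rule integral_dominated_convergence[where w = "\<lambda>x. \<bar>F x\<bar>"])
      show "AE x in lebesgue. (\<lambda>n. F x * ?\<phi> n x) \<longlonglongrightarrow> F x * indicator (box a b) x"
        by (intro AE_I2 tendsto_mult tendsto_const box_bump_tendsto)
      show "AE x in lebesgue. norm (F x * ?\<phi> n x) \<le> \<bar>F x\<bar>" for n
        using box_bump_bounds[of "real (Suc n)" a b]
        by (intro AE_I2) (simp add: abs_mult mult_left_le)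
      have "?\<phi> n \<in> borel_measurable lebesgue" for n
        using test_funs_measurable[OF \<phi>(1)] by (simp add: measurable_completion)
      then show "(\<lambda>x. F x * ?\<phi> n x) \<in> borel_measurable lebesgue" for n
        using F by auto
      show "(\<lambda>x. F x * indicator (box a b) x) \<in> borel_measurable lebesgue"
        using F by (intro borel_measurable_times borel_measurable_indicator) auto
      show "integrable lebesgue (\<lambda>x. \<bar>F x\<bar>)"
        using F by simp
    qed
    moreover have "(\<lambda>n. \<integral>x. F x * ?\<phi> n x \<partial>lebesgue) = (\<lambda>n. 0)"
    proof
      fix n
      have "(\<lambda>x. F x * ?\<phi> n x) = (\<lambda>x. g x * ?\<phi> n x)"
        using test_funs_zero_outside[OF \<phi>(2)] by (auto simp: F_def indicator_def fun_eq_iff)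
      then show "(\<integral>x. F x * ?\<phi> n x \<partial>lebesgue) = 0"
        using zero[OF \<phi>(1)[of n]] test_funs_zero_outside[OF \<phi>(1)] \<open>open G\<close>
        by (simp add: integral_lebesgue_on_open)
    qed
    ultimately have "(\<integral>x. F x * indicator (box a b) x \<partial>lebesgue) = 0"
      by (simp only: LIMSEQ_const_iff)
    moreover have "set_integrable lebesgue (box a b) F"
      unfolding set_integrable_def using F by (intro integrable_mult_indicator) auto
    ultimately have "integral (box a b) F = 0"
      using set_lebesgue_integral_eq_integral(2)[of "box a b" F]
      by (simp add: set_lebesgue_integral_def mult.commute)
    then show ?thesis
      by (simp add: integral_open_interval)
  qed
  have "F integrable_on cbox a b" for a b
  proof -
    have "set_integrable lebesgue (cbox a b) F"
      unfolding set_integrable_def using F by (intro integrable_mult_indicator) auto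
    then show ?thesis
      by (rule set_lebesgue_integral_eq_integral(1))
  qed
  \<comment> \<open>Lebesgue differentiation along cubes that have x as their lower corner.\<close>
  then obtain N where N: "negligible N"
    "\<And>x e. \<lbrakk>x \<notin> N; 0 < e\<rbrakk> \<Longrightarrow> \<exists>\<delta>>0. \<forall>h. 0 < h \<and> h < \<delta> \<longrightarrow>
       norm (integral (cbox x (x + h *\<^sub>R One)) F /\<^sub>R h ^ DIM(real^'d) - F x) < e"
    using integrable_ccontinuous_explicit[of F] by blast
  \<comment> \<open>In the open box all sufficiently small cubes with corner x stay inside
    \<open>cbox c d\<close>, so their averages are 0. The faces of the box join the null set
    afterwards.\<close>
  have "F x = 0" if x: "x \<in> box c d" "x \<notin> N" for x
  proof -
    have "((\<lambda>h. x + h *\<^sub>R One) \<longlongrightarrow> x + 0 *\<^sub>R One) (at_right (0::real))"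
      by (intro tendsto_intros)
    then have "\<forall>\<^sub>F h in at_right (0::real). x + h *\<^sub>R One \<in> box c d"
      using x(1) by (intro topological_tendstoD) auto
    then obtain h0 where h0: "h0 > 0" "\<And>h. 0 < h \<Longrightarrow> h < h0 \<Longrightarrow> x + h *\<^sub>R One \<in> box c d"
      by (auto simp: eventually_at_right_field)
    have "norm (F x) < e" if "e > 0" for e
    proof -
      obtain \<delta> where \<delta>: "\<delta> > 0" "\<And>h. 0 < h \<Longrightarrow> h < \<delta> \<Longrightarrow>
          norm (integral (cbox x (x + h *\<^sub>R One)) F /\<^sub>R h ^ DIM(real^'d) - F x) < e"
        using N(2)[OF x(2) \<open>e > 0\<close>] by blast
      obtain h where h: "0 < h" "h < \<delta>" "h < h0"
        using dense[of 0 "min \<delta> h0"] \<delta>(1) h0(1) by auto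
      have "cbox x (x + h *\<^sub>R One) \<subseteq> cbox c d"
        using x(1) h0(2)[OF h(1,3)] by (auto simp: mem_box intro: order_trans less_imp_le) (meson less_imp_le order_trans)+
      then show ?thesis
        using \<delta>(2)[OF h(1,2)] zero_box by simp
    qed
    then show ?thesis
      by (metis less_irrefl zero_less_norm_iff)
  qed
  then have "\<forall>x\<in>cbox c d - (N \<union> (cbox c d - box c d)). g x = 0"
    using box_subset_cbox[of c d] by (auto simp: F_def indicator_def)
  moreover have "negligible (N \<union> (cbox c d - box c d))"
    using N(1) by (intro negligible_Un negligible_frontier_interval)
  ultimately show ?thesis
    by blast
qed

lemma AE_lebesgue_onI:
  assumes "open G" "negligible N" "\<And>x. x \<in> G - N \<Longrightarrow> P x"
  shows "AE x in lebesgue_on G. P x"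
proof -
  have "AE x in lebesgue. x \<in> G \<longrightarrow> P x"
    using assms by (intro AE_I'[of N]) (auto simp: negligible_iff_null_sets)
  then show ?thesis
    using assms(1) by (simp add: AE_restrict_space_iff)
qed

text \<open>An open set is a countable union of closed boxes, and the exceptional sets of countably
  many boxes still form a null set.\<close>

lemma fundamental_lemma:
  fixes g :: "real^'d::finite \<Rightarrow> real"
  assumes "open G" "g \<in> sq_integrable G"
    and "\<And>\<phi>. \<phi> \<in> test_funs G \<Longrightarrow> (\<integral>x. g x * \<phi> x \<partial>lebesgue_on G) = 0"
  shows "AE x in lebesgue_on G. g x = 0"
proof -
  obtain \<D> where \<D>: "countable \<D>" "\<D> \<subseteq> Pow G" "\<And>X. X \<in> \<D> \<Longrightarrow> \<exists>a b. X = cbox a b" "\<Union>\<D> = G"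
    using open_countable_Union_open_cbox[OF assms(1)] by blast
  have "\<forall>X\<in>\<D>. \<exists>N. negligible N \<and> (\<forall>x\<in>X - N. g x = 0)"
    using fundamental_lemma_box[OF assms] \<D>(2,3) by (metis PowD subsetD)
  then obtain N where N: "\<And>X. X \<in> \<D> \<Longrightarrow> negligible (N X)" "\<And>X x. X \<in> \<D> \<Longrightarrow> x \<in> X - N X \<Longrightarrow> g x = 0"
    by metis
  show ?thesis
  proof (rule AE_lebesgue_onI[OF assms(1)])
    show "negligible (\<Union>(N ` \<D>))"
      using \<D>(1) N(1) by (intro negligible_countable_Union) auto
    show "g x = 0" if "x \<in> G - \<Union>(N ` \<D>)" for x
      using that \<D>(4) N(2) by blast
  qed
qed


section \<open>Integration by parts\<close>

text \<open>Difference quotients have integral zero by translation invariance; this replaces Fubini.\<close>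

lemma integral_directional_derivative:
  fixes g g' :: "'a::euclidean_space \<Rightarrow> real"
  assumes g: "continuous_on UNIV g" and g': "continuous_on UNIV g'"
    and deriv: "\<And>x s. ((\<lambda>t. g (x + t *\<^sub>R e)) has_field_derivative g' (x + s *\<^sub>R e)) (at s)"
    and K: "compact K" "\<And>x. x \<notin> K \<Longrightarrow> g x = 0" "\<And>x. x \<notin> K \<Longrightarrow> g' x = 0"
  shows "(\<integral>x. g' x \<partial>lborel) = 0"
proof -
  let ?h = "\<lambda>n. inverse (real (Suc n))"
  let ?q = "\<lambda>n x. (g (x + ?h n *\<^sub>R e) - g x) / ?h n"
  obtain M where M: "\<And>x. \<bar>g' x\<bar> \<le> M"
  proof -
    obtain B where "\<And>x. x \<in> K \<Longrightarrow> norm (g' x) \<le> B"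
      using compact_imp_bounded[OF compact_continuous_image[OF continuous_on_subset[OF g'] K(1)]]
      by (auto simp: bounded_iff)
    then have "\<bar>g' x\<bar> \<le> max B 0" for x
      by (cases "x \<in> K") (use K(3) in \<open>force+\<close>)
    then show ?thesis
      using that by blast
  qed
  obtain R where R: "\<And>x. x \<in> K \<Longrightarrow> norm x \<le> R"
    using compact_imp_bounded[OF K(1)] by (auto simp: bounded_iff)
  have int_g: "integrable lborel g"
    by (rule compact_support_integrable[OF K(1) g K(2)])
  have trans: "integrable lborel (\<lambda>x. g (x + c))" "(\<integral>x. g (x + c) \<partial>lborel) = (\<integral>x. g x \<partial>lborel)" for c
    using int_g lborel_distr_plus[of c] integral_distr[of "(+) c" lborel borel g]
      integrable_distr_eq[of "(+) c" lborel borel g] borel_measurable_continuous_onI[OF g]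
    by (simp_all add: add.commute)
  have "(\<lambda>n. \<integral>x. ?q n x \<partial>lborel) \<longlonglongrightarrow> (\<integral>x. g' x \<partial>lborel)"
  \<comment> \<open>Steps have length at most 1 in units of e, so outside the ball of radius R +
    norm e neither x nor the shifted point lies in K, and the quotient is 0.\<close>
  proof (rule integral_dominated_convergence[where w = "\<lambda>x. indicator (cball 0 (R + norm e)) x *\<^sub>R M"])
    show "g' \<in> borel_measurable lborel" "?q n \<in> borel_measurable lborel" for n
      using borel_measurable_continuous_onI[OF g'] int_g trans(1) by auto
    show "integrable lborel (\<lambda>x. indicator (cball 0 (R + norm e)) x *\<^sub>R M)"
      by (intro borel_integrable_compact) auto
    show "AE x in lborel. (\<lambda>n. ?q n x) \<longlonglongrightarrow> g' x"
    proof (rule AE_I2)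
      fix x
      have "((\<lambda>h. (g (x + h *\<^sub>R e) - g x) / h) \<longlongrightarrow> g' x) (at 0)"
        using deriv[of x 0] by (simp add: DERIV_def)
      moreover have "filterlim ?h (at 0) sequentially"
        using LIMSEQ_inverse_real_of_nat by (simp add: filterlim_at)
      ultimately show "(\<lambda>n. ?q n x) \<longlonglongrightarrow> g' x"
        by (rule filterlim_compose)
    qed
    show "AE x in lborel. norm (?q n x) \<le> indicator (cball 0 (R + norm e)) x *\<^sub>R M" for n
    proof (rule AE_I2)
      fix x
      have h: "0 < ?h n" "?h n \<le> 1"
        by (auto simp: field_simps)
      show "norm (?q n x) \<le> indicator (cball 0 (R + norm e)) x *\<^sub>R M"
      proof (cases "x \<in> cball 0 (R + norm e)")
        case True
        \<comment> \<open>The mean value theorem turns the quotient into a value of g', which M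
          bounds uniformly in n.\<close>
        obtain z where "g (x + ?h n *\<^sub>R e) - g (x + 0 *\<^sub>R e) = (?h n - 0) * g' (x + z *\<^sub>R e)"
          using MVT2[OF h(1), of "\<lambda>t. g (x + t *\<^sub>R e)" "\<lambda>s. g' (x + s *\<^sub>R e)"] deriv by metis
        then have "?q n x = g' (x + z *\<^sub>R e)"
          by simp
        then show ?thesis
          using True M by simp
      next
        case False
        have "norm (?h n *\<^sub>R e) \<le> norm e"
          using h by (simp add: mult_left_le_one_le)
        then have "norm x \<le> norm (x + ?h n *\<^sub>R e) + norm e"
          using norm_triangle_ineq4[of "x + ?h n *\<^sub>R e" "?h n *\<^sub>R e"] by simp
        then have "x \<notin> K" "x + ?h n *\<^sub>R e \<notin> K"
          using False R[of x] R[of "x + ?h n *\<^sub>R e"] norm_ge_zero[of e] by auto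
        then show ?thesis
          using False K(2) by simp
      qed
    qed
  qed
  moreover have "(\<lambda>n. \<integral>x. ?q n x \<partial>lborel) = (\<lambda>n. 0)"
    using trans int_g by simp
  ultimately show ?thesis
    by (simp only: LIMSEQ_const_iff)
qed

text \<open>The product \<phi>\<psi> inherits compact support from \<phi>, so its directional
  derivative has integral 0; the product rule splits that integral.\<close>

lemma integral_pderiv_dir_parts:
  assumes \<phi>: "\<phi> \<in> test_funs G" and \<psi>: "smooth \<psi>"
  shows "(\<integral>x. \<phi> x * pderiv_dir i \<psi> x \<partial>lborel) = - (\<integral>x. pderiv_dir i \<phi> x * \<psi> x \<partial>lborel)"
proof -
  let ?\<phi>' = "pderiv_dir i \<phi>" and ?\<psi>' = "pderiv_dir i \<psi>"
  obtain K where K: "compact K" "\<And>x. x \<notin> K \<Longrightarrow> \<phi> x = 0" "\<And>x. x \<notin> K \<Longrightarrow> ?\<phi>' x = 0"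
  proof
    show "compact (closure {x. \<phi> x \<noteq> 0})"
      using \<phi> by (auto simp: test_funs_def)
    show "\<phi> x = 0" "?\<phi>' x = 0" if "x \<notin> closure {x. \<phi> x \<noteq> 0}" for x
      using that pderiv_dir_support[of i \<phi>] closure_subset[of "{x. \<phi> x \<noteq> 0}"]
        closure_subset[of "{x. ?\<phi>' x \<noteq> 0}"] by auto
  qed
  have cont: "continuous_on UNIV \<phi>" "continuous_on UNIV \<psi>" "continuous_on UNIV ?\<phi>'" "continuous_on UNIV ?\<psi>'"
    using test_funs_continuous[OF \<phi>] smooth_continuous[OF \<psi>]
      test_funs_continuous[OF test_funs_pderiv_dir[OF \<phi>]] smooth_continuous[OF smooth_foldr[OF \<psi>, of "[i]"]]
    by auto
  have "(\<integral>x. ?\<phi>' x * \<psi> x + \<phi> x * ?\<psi>' x \<partial>lborel) = 0"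
  proof (rule integral_directional_derivative[where g = "\<lambda>x. \<phi> x * \<psi> x" and e = "axis i 1" and K = K])
    show "((\<lambda>t. \<phi> (x + t *\<^sub>R axis i 1) * \<psi> (x + t *\<^sub>R axis i 1)) has_field_derivative
        ?\<phi>' (x + s *\<^sub>R axis i 1) * \<psi> (x + s *\<^sub>R axis i 1) +
        \<phi> (x + s *\<^sub>R axis i 1) * ?\<psi>' (x + s *\<^sub>R axis i 1)) (at s)" for x s
      using DERIV_mult[OF smooth_deriv[OF test_funs_smooth[OF \<phi>]] smooth_deriv[OF \<psi>]]
      by (simp add: mult.commute)
  qed (use K cont in \<open>auto intro!: continuous_intros\<close>)
  moreover have "integrable lborel (\<lambda>x. ?\<phi>' x * \<psi> x)" "integrable lborel (\<lambda>x. \<phi> x * ?\<psi>' x)"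
    using K cont by (auto intro!: compact_support_integrable[of K] continuous_intros)
  ultimately show ?thesis
    by simp
qed

text \<open>\<open>foldr\<close> applies the head of the list last. The outermost derivative of
  \<psi> is thus the first to move and becomes the innermost one on \<phi>, whence
  \<open>rev\<close>.\<close>

lemma integral_foldr_pderiv_dir_parts:
  assumes "\<phi> \<in> test_funs G" "smooth \<psi>"
  shows "(\<integral>x. \<phi> x * foldr pderiv_dir is \<psi> x \<partial>lborel) =
    (-1) ^ length is * (\<integral>x. foldr pderiv_dir (rev is) \<phi> x * \<psi> x \<partial>lborel)"
  using assms(1)
proof (induction "is" arbitrary: \<phi>)
  case (Cons i "is")
  have "(\<integral>x. \<phi> x * foldr pderiv_dir (i # is) \<psi> x \<partial>lborel) =
      - (\<integral>x. pderiv_dir i \<phi> x * foldr pderiv_dir is \<psi> x \<partial>lborel)"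
    using integral_pderiv_dir_parts[OF Cons.prems smooth_foldr[OF assms(2)]] by simp
  then show ?case
    using Cons.IH[OF test_funs_pderiv_dir[OF Cons.prems]] by simp
qed simp


section \<open>Multi-indices\<close>

text \<open>As the index type is finite, a multi-index is the count function of a multiset, and any
  listing of that multiset realizes it.\<close>

lemma count_list_exists: "\<exists>is. count_list is = (\<alpha> :: 'd::finite \<Rightarrow> nat)"
proof -
  obtain "is" where "mset is = Abs_multiset \<alpha>"
    using ex_mset by blast
  then have "count (mset is) = \<alpha>"
    by (simp add: Abs_multiset_inverse)
  then show ?thesis
    by (metis count_mset ext)
qed

text \<open>The very choice made inside \<open>mderiv\<close>, named so that the same list can be
  reversed.\<close>

definition mi_list :: "('d::finite \<Rightarrow> nat) \<Rightarrow> 'd list" where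
  "mi_list \<alpha> = (SOME is. count_list is = \<alpha>)"

lemma count_mi_list: "count_list (mi_list \<alpha>) = \<alpha>"
  unfolding mi_list_def by (rule someI_ex[OF count_list_exists])

lemma length_mi_list: "length (mi_list \<alpha>) = mi_order \<alpha>"
  using sum_count_set[of "mi_list \<alpha>" UNIV] by (simp add: mi_order_def count_mi_list)

lemma mi_order_0 [simp]: "mi_order (\<lambda>_. 0) = 0"
  by (simp add: mi_order_def)

lemma mi_list_0: "mi_list (\<lambda>_. 0) = []"
  using length_mi_list[of "\<lambda>_. 0"] by simp

lemma finite_mi_order_le: "finite {\<alpha> :: 'd::finite \<Rightarrow> nat. mi_order \<alpha> \<le> m}"
proof (rule finite_subset)
  show "{\<alpha> :: 'd \<Rightarrow> nat. mi_order \<alpha> \<le> m} \<subseteq> {\<alpha>. \<forall>i. (i \<in> UNIV \<longrightarrow> \<alpha> i \<in> {..m}) \<and> (i \<notin> UNIV \<longrightarrow> \<alpha> i = 0)}"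
  proof -
    have "\<alpha> i \<le> mi_order \<alpha>" for \<alpha> :: "'d \<Rightarrow> nat" and i
      unfolding mi_order_def by (rule member_le_sum) auto
    then show ?thesis
      by (auto intro: order_trans)
  qed
  show "finite {\<alpha> :: 'd \<Rightarrow> nat. \<forall>i. (i \<in> UNIV \<longrightarrow> \<alpha> i \<in> {..m}) \<and> (i \<notin> UNIV \<longrightarrow> \<alpha> i = 0)}"
    by (rule finite_set_of_finite_funs) auto
qed

lemma mderiv_eq: "mderiv \<alpha> f = foldr pderiv_dir (mi_list \<alpha>) f"
  by (simp add: mderiv_def mi_list_def)

lemma mderiv_0 [simp]: "mderiv (\<lambda>_. 0) f = f"
  by (simp add: mderiv_eq mi_list_0)

text \<open>Integration by parts reverses the order in which the partial derivatives are taken. With the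
  reversed derivative the symmetry of mixed partial derivatives is never needed.\<close>

definition mderiv_rev :: "('d::finite \<Rightarrow> nat) \<Rightarrow> (real^'d \<Rightarrow> real) \<Rightarrow> real^'d \<Rightarrow> real" where
  "mderiv_rev \<alpha> f = foldr pderiv_dir (rev (mi_list \<alpha>)) f"

lemma mderiv_rev_0 [simp]: "mderiv_rev (\<lambda>_. 0) f = f"
  by (simp add: mderiv_rev_def mi_list_0)

lemma test_funs_mderiv: "\<phi> \<in> test_funs G \<Longrightarrow> mderiv \<alpha> \<phi> \<in> test_funs G"
  and test_funs_mderiv_rev: "\<phi> \<in> test_funs G \<Longrightarrow> mderiv_rev \<alpha> \<phi> \<in> test_funs G"
  by (simp_all add: mderiv_eq mderiv_rev_def test_funs_foldr)

section \<open>Linearity of iterated derivatives and of the space of test functions\<close>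

lemma foldr_pderiv_dir_add:
  assumes "smooth f" "smooth g"
  shows "foldr pderiv_dir is (\<lambda>x. f x + g x) = (\<lambda>x. foldr pderiv_dir is f x + foldr pderiv_dir is g x)"
proof (induction "is")
  case (Cons i "is")
  have "pderiv_dir i (\<lambda>x. foldr pderiv_dir is f x + foldr pderiv_dir is g x) x =
      pderiv_dir i (foldr pderiv_dir is f) x + pderiv_dir i (foldr pderiv_dir is g) x" for x
  proof -
    \<comment> \<open>\<open>deriv\<close> is additive only where both derivatives exist, so
      smoothness is invoked for the iterates, not just for f and g.\<close>
    have "((\<lambda>t. foldr pderiv_dir is f (x + t *\<^sub>R axis i 1) + foldr pderiv_dir is g (x + t *\<^sub>R axis i 1))
        has_field_derivative pderiv_dir i (foldr pderiv_dir is f) (x + 0 *\<^sub>R axis i 1) +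
          pderiv_dir i (foldr pderiv_dir is g) (x + 0 *\<^sub>R axis i 1)) (at 0)"
      using assms by (intro DERIV_add smooth_deriv smooth_foldr)
    then show ?thesis
      unfolding pderiv_dir_def[of i "\<lambda>x. foldr pderiv_dir is f x + foldr pderiv_dir is g x"]
      by (simp add: DERIV_imp_deriv)
  qed
  then show ?case
    by (simp add: Cons.IH fun_eq_iff)
qed simp

lemma foldr_pderiv_dir_scale:
  assumes "smooth f"
  shows "foldr pderiv_dir is (\<lambda>x. c * f x) = (\<lambda>x. c * foldr pderiv_dir is f x)"
proof (induction "is")
  case (Cons i "is")
  have "pderiv_dir i (\<lambda>x. c * foldr pderiv_dir is f x) x = c * pderiv_dir i (foldr pderiv_dir is f) x" for x
  proof -
    have "((\<lambda>t. c * foldr pderiv_dir is f (x + t *\<^sub>R axis i 1))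
        has_field_derivative c * pderiv_dir i (foldr pderiv_dir is f) (x + 0 *\<^sub>R axis i 1)) (at 0)"
      using assms by (intro DERIV_cmult smooth_deriv smooth_foldr)
    then show ?thesis
      unfolding pderiv_dir_def[of i "\<lambda>x. c * foldr pderiv_dir is f x"]
      by (simp add: DERIV_imp_deriv)
  qed
  then show ?case
    by (simp add: Cons.IH fun_eq_iff)
qed simp

lemma closure_compact_subset:
  fixes S K :: "'a::metric_space set"
  assumes "S \<subseteq> K" "compact K"
  shows "compact (closure S)" "closure S \<subseteq> K"
  using assms compact_Int_closed[of K "closure S"] closure_minimal[OF assms(1) compact_imp_closed[OF assms(2)]]
  by (auto simp: Int_absorb1)

lemma test_funs_add:
  assumes "\<phi> \<in> test_funs G" "\<psi> \<in> test_funs G"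
  shows "(\<lambda>x. \<phi> x + \<psi> x) \<in> test_funs G"
proof -
  let ?K = "closure {x. \<phi> x \<noteq> 0} \<union> closure {x. \<psi> x \<noteq> 0}"
  have K: "compact ?K" "?K \<subseteq> G"
    using assms by (auto simp: test_funs_def)
  have "{x. \<phi> x + \<psi> x \<noteq> 0} \<subseteq> {x. \<phi> x \<noteq> 0} \<union> {x. \<psi> x \<noteq> 0}"
    by auto
  then have "{x. \<phi> x + \<psi> x \<noteq> 0} \<subseteq> ?K"
    by (rule order_trans[OF _ Un_mono[OF closure_subset closure_subset]])
  note closure_compact_subset[OF this K(1)]
  moreover have "smooth (\<lambda>x. \<phi> x + \<psi> x)"
    unfolding smooth_def
  proof (intro allI conjI)
    fix "is" :: "'a list" and i x
    note \<phi> = smooth_foldr[OF test_funs_smooth[OF assms(1)], of "is"]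
      and \<psi> = smooth_foldr[OF test_funs_smooth[OF assms(2)], of "is"]
    show "continuous_on UNIV (foldr pderiv_dir is (\<lambda>x. \<phi> x + \<psi> x))"
      using smooth_continuous[OF \<phi>] smooth_continuous[OF \<psi>] assms
      by (simp add: foldr_pderiv_dir_add test_funs_smooth continuous_on_add)
    show "(\<lambda>t. foldr pderiv_dir is (\<lambda>x. \<phi> x + \<psi> x) (x + t *\<^sub>R axis i 1)) differentiable at 0"
      using DERIV_add[OF smooth_deriv[OF \<phi>, of x i 0] smooth_deriv[OF \<psi>, of x i 0]] assms
      by (auto simp: foldr_pderiv_dir_add test_funs_smooth real_differentiable_def)
  qed
  ultimately show ?thesis
    using K(2) by (auto simp: test_funs_def)
qed

lemma test_funs_scale:
  assumes "\<phi> \<in> test_funs G"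
  shows "(\<lambda>x. c * \<phi> x) \<in> test_funs G"
proof -
  let ?K = "closure {x. \<phi> x \<noteq> 0}"
  have K: "compact ?K" "?K \<subseteq> G"
    using assms by (auto simp: test_funs_def)
  have "{x. c * \<phi> x \<noteq> 0} \<subseteq> ?K"
    using closure_subset[of "{x. \<phi> x \<noteq> 0}"] by auto
  note closure_compact_subset[OF this K(1)]
  moreover have "smooth (\<lambda>x. c * \<phi> x)"
    unfolding smooth_def
  proof (intro allI conjI)
    fix "is" :: "'a list" and i x
    note \<phi> = smooth_foldr[OF test_funs_smooth[OF assms(1)], of "is"]
    show "continuous_on UNIV (foldr pderiv_dir is (\<lambda>x. c * \<phi> x))"
      using smooth_continuous[OF \<phi>] assms
      by (simp add: foldr_pderiv_dir_scale test_funs_smooth continuous_on_mult_left)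
    show "(\<lambda>t. foldr pderiv_dir is (\<lambda>x. c * \<phi> x) (x + t *\<^sub>R axis i 1)) differentiable at 0"
      using DERIV_cmult[OF smooth_deriv[OF \<phi>, of x i 0], of c] assms
      by (auto simp: foldr_pderiv_dir_scale test_funs_smooth real_differentiable_def)
  qed
  ultimately show ?thesis
    using K(2) by (auto simp: test_funs_def)
qed

lemma mderiv_rev_add:
  "\<phi> \<in> test_funs G \<Longrightarrow> \<psi> \<in> test_funs G \<Longrightarrow>
    mderiv_rev \<alpha> (\<lambda>x. \<phi> x + \<psi> x) = (\<lambda>x. mderiv_rev \<alpha> \<phi> x + mderiv_rev \<alpha> \<psi> x)"
  and mderiv_rev_scale:
  "\<phi> \<in> test_funs G \<Longrightarrow> mderiv_rev \<alpha> (\<lambda>x. c * \<phi> x) = (\<lambda>x. c * mderiv_rev \<alpha> \<phi> x)"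
  by (simp_all add: mderiv_rev_def foldr_pderiv_dir_add foldr_pderiv_dir_scale test_funs_smooth)

text \<open>Both integrands vanish off G, so the integrals may be taken over the whole space, where
  no boundary terms arise.\<close>

lemma integral_mderiv_parts:
  assumes "open G" "\<phi> \<in> test_funs G" "\<psi> \<in> test_funs G"
  shows "(\<integral>x. \<phi> x * mderiv \<alpha> \<psi> x \<partial>lebesgue_on G) =
    (-1) ^ mi_order \<alpha> * (\<integral>x. mderiv_rev \<alpha> \<phi> x * \<psi> x \<partial>lebesgue_on G)"
proof -
  have *: "(\<integral>x. f x * g x \<partial>lebesgue_on G) = (\<integral>x. f x * g x \<partial>lborel)"
    if "f \<in> test_funs G" "g \<in> test_funs G" for f g :: "real^'a \<Rightarrow> real"
    using that test_funs_measurable[OF that(1)] test_funs_measurable[OF that(2)]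
    by (simp add: integral_lebesgue_on_open[OF assms(1)] test_funs_zero_outside integral_completion)
  show ?thesis
    using integral_foldr_pderiv_dir_parts[OF assms(2) test_funs_smooth[OF assms(3)], of "mi_list \<alpha>"]
      *[OF assms(2) test_funs_mderiv[OF assms(3)]] *[OF test_funs_mderiv_rev[OF assms(2)] assms(3)]
    by (simp add: mderiv_eq mderiv_rev_def length_mi_list)
qed


section \<open>Classes of functions and their weak derivatives\<close>

lemma cls_eq_iff:
  assumes "f \<in> sq_integrable G" "g \<in> sq_integrable G"
  shows "cls G f = cls G g \<longleftrightarrow> (AE x in lebesgue_on G. f x = g x)"
proof
  assume "cls G f = cls G g"
  then have "g \<in> cls G f"
    using assms by (simp add: cls_def ae_eq_def)
  then show "AE x in lebesgue_on G. f x = g x"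
    by (simp add: cls_def ae_eq_def)
next
  assume eq: "AE x in lebesgue_on G. f x = g x"
  have "(AE x in lebesgue_on G. f x = h x) \<longleftrightarrow> (AE x in lebesgue_on G. g x = h x)" for h
    using eq by (auto elim: AE_mp)
  then show "cls G f = cls G g"
    using assms by (auto simp: cls_def ae_eq_def)
qed

lemma rep_cls:
  assumes "f \<in> sq_integrable G"
  shows "rep (cls G f) \<in> sq_integrable G" "AE x in lebesgue_on G. rep (cls G f) x = f x"
proof -
  have "f \<in> cls G f"
    using assms by (simp add: cls_def ae_eq_def)
  then have "rep (cls G f) \<in> cls G f"
    unfolding rep_def by (rule someI[of "\<lambda>h. h \<in> cls G f"])
  then show "rep (cls G f) \<in> sq_integrable G" "AE x in lebesgue_on G. rep (cls G f) x = f x"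
    by (auto simp: cls_def ae_eq_def elim: AE_mp)
qed

lemma L2_iff: "u \<in> L2 G \<longleftrightarrow> (\<exists>f\<in>sq_integrable G. u = cls G f)"
  by (auto simp: L2_def quotient_def cls_def)

lemma L2_norm_cls:
  assumes "f \<in> sq_integrable G"
  shows "L2_norm G (cls G f) = sqrt (\<integral>x. (f x)\<^sup>2 \<partial>lebesgue_on G)"
proof -
  have "(\<integral>x. (rep (cls G f) x)\<^sup>2 \<partial>lebesgue_on G) = (\<integral>x. (f x)\<^sup>2 \<partial>lebesgue_on G)"
    using rep_cls[OF assms] assms
    by (intro integral_cong_AE) (auto dest: sq_integrableD elim: AE_mp)
  then show ?thesis
    by (simp add: L2_norm_def)
qed

text \<open>Stated for functions rather than classes, which keeps the arbitrary representative
  \<open>rep\<close> out of the computations; \<open>is_weak_deriv_cls\<close> translates.\<close>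

definition weak_deriv_fun ::
  "(real^'d::finite) set \<Rightarrow> ('d \<Rightarrow> nat) \<Rightarrow> (real^'d \<Rightarrow> real) \<Rightarrow> (real^'d \<Rightarrow> real) \<Rightarrow> bool" where
  "weak_deriv_fun G \<alpha> f g \<longleftrightarrow> (\<forall>\<phi>\<in>test_funs G. (\<integral>x. f x * mderiv \<alpha> \<phi> x \<partial>lebesgue_on G) =
     (-1) ^ mi_order \<alpha> * (\<integral>x. g x * \<phi> x \<partial>lebesgue_on G))"

lemma integral_rep_cls_test:
  assumes "f \<in> sq_integrable G" "\<phi> \<in> test_funs G"
  shows "(\<integral>x. rep (cls G f) x * \<phi> x \<partial>lebesgue_on G) = (\<integral>x. f x * \<phi> x \<partial>lebesgue_on G)"
proof (rule integral_cong_AE)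
  have "\<phi> \<in> borel_measurable (lebesgue_on G)"
    using test_funs_measurable[OF assms(2)] by (rule borel_measurable_lebesgue_on)
  then show "(\<lambda>x. rep (cls G f) x * \<phi> x) \<in> borel_measurable (lebesgue_on G)"
    "(\<lambda>x. f x * \<phi> x) \<in> borel_measurable (lebesgue_on G)"
    using sq_integrableD(1)[OF rep_cls(1)[OF assms(1)]] sq_integrableD(1)[OF assms(1)]
    by (auto intro: borel_measurable_times)
  show "AE x in lebesgue_on G. rep (cls G f) x * \<phi> x = f x * \<phi> x"
    using rep_cls(2)[OF assms(1)] by (auto elim: AE_mp)
qed

lemma is_weak_deriv_cls:
  assumes "f \<in> sq_integrable G" "g \<in> sq_integrable G"
  shows "is_weak_deriv G \<alpha> (cls G f) (cls G g) \<longleftrightarrow> weak_deriv_fun G \<alpha> f g"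
proof -
  have "cls G g \<in> L2 G"
    using assms(2) L2_iff by blast
  then show ?thesis
    unfolding is_weak_deriv_def weak_deriv_fun_def
    using assms by (simp add: integral_rep_cls_test test_funs_mderiv)
qed

text \<open>The sign in the defining identity cancels, so g - h is orthogonal to every test
  function.\<close>

lemma weak_deriv_fun_unique:
  assumes "open G" "g \<in> sq_integrable G" "h \<in> sq_integrable G"
    and "weak_deriv_fun G \<alpha> f g" "weak_deriv_fun G \<alpha> f h"
  shows "AE x in lebesgue_on G. g x = h x"
proof -
  have "AE x in lebesgue_on G. g x - h x = 0"
  proof (rule fundamental_lemma[OF assms(1) sq_integrable_diff[OF assms(2,3)]])
    fix \<phi> assume \<phi>: "\<phi> \<in> test_funs G"
    have "(\<integral>x. g x * \<phi> x \<partial>lebesgue_on G) = (\<integral>x. h x * \<phi> x \<partial>lebesgue_on G)"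
      using bspec[OF assms(4)[unfolded weak_deriv_fun_def] \<phi>]
        bspec[OF assms(5)[unfolded weak_deriv_fun_def] \<phi>] by simp
    then show "(\<integral>x. (g x - h x) * \<phi> x \<partial>lebesgue_on G) = 0"
      using sq_integrable_mult[OF assms(2) test_funs_sq_integrable[OF \<phi> assms(1)]]
        sq_integrable_mult[OF assms(3) test_funs_sq_integrable[OF \<phi> assms(1)]]
      by (simp add: left_diff_distrib)
  qed
  then show ?thesis
    by simp
qed

text \<open>Evaluates \<open>THE\<close>: any square-integrable function that satisfies the identity
  represents the weak derivative, and norms may be computed from it.\<close>

lemma weak_deriv_cls:
  assumes "open G" "f \<in> sq_integrable G" "g \<in> sq_integrable G" "weak_deriv_fun G \<alpha> f g"
  shows "weak_deriv G \<alpha> (cls G f) = cls G g"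
  unfolding weak_deriv_def
proof (rule the_equality)
  show "is_weak_deriv G \<alpha> (cls G f) (cls G g)"
    using assms by (simp add: is_weak_deriv_cls)
  fix w assume w: "is_weak_deriv G \<alpha> (cls G f) w"
  then obtain h where h: "h \<in> sq_integrable G" "w = cls G h"
    unfolding is_weak_deriv_def L2_iff by blast
  then have "weak_deriv_fun G \<alpha> f h"
    using w assms(2) by (simp add: is_weak_deriv_cls)
  then show "w = cls G g"
    using weak_deriv_fun_unique[OF assms(1) h(1) assms(3) _ assms(4)] h assms(3) by (simp add: cls_eq_iff)
qed

lemma Sob_add_cls:
  assumes "f \<in> sq_integrable G" "g \<in> sq_integrable G"
  shows "add (Sob m G) (cls G f) (cls G g) = cls G (\<lambda>x. f x + g x)"
proof -
  have "AE x in lebesgue_on G. rep (cls G f) x + rep (cls G g) x = f x + g x"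
    using rep_cls(2)[OF assms(1)] rep_cls(2)[OF assms(2)] by eventually_elim simp
  then show ?thesis
    using rep_cls(1)[OF assms(1)] rep_cls(1)[OF assms(2)] assms
    by (simp add: Sob_def cls_eq_iff sq_integrable_add)
qed

lemma Sob_scl_cls:
  assumes "f \<in> sq_integrable G"
  shows "scl (Sob m G) c (cls G f) = cls G (\<lambda>x. c * f x)"
proof -
  have "AE x in lebesgue_on G. c * rep (cls G f) x = c * f x"
    using rep_cls(2)[OF assms] by eventually_elim simp
  then show ?thesis
    using rep_cls(1)[OF assms] assms by (simp add: Sob_def cls_eq_iff sq_integrable_scale)
qed


section \<open>Jets of Sobolev functions\<close>

text \<open>Carrying representatives of all weak derivatives as data makes the Sobolev norm an
  explicit sum of integrals. The function itself is the component at the zero multi-index.\<close>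

definition is_jet ::
  "nat \<Rightarrow> (real^'d::finite) set \<Rightarrow> (('d \<Rightarrow> nat) \<Rightarrow> real^'d \<Rightarrow> real) \<Rightarrow> bool" where
  "is_jet m G F \<longleftrightarrow> (\<forall>\<alpha>. mi_order \<alpha> \<le> m \<longrightarrow>
     F \<alpha> \<in> sq_integrable G \<and> weak_deriv_fun G \<alpha> (F (\<lambda>_. 0)) (F \<alpha>))"

text \<open>No weak derivative occurs in the next definition: limits of jets of test functions turn out to
  be jets. In this form the closure of the test functions is visibly stable under extension by zero.\<close>

definition is_jet0 ::
  "nat \<Rightarrow> (real^'d::finite) set \<Rightarrow> (('d \<Rightarrow> nat) \<Rightarrow> real^'d \<Rightarrow> real) \<Rightarrow> bool" where
  "is_jet0 m G F \<longleftrightarrow> (\<forall>\<alpha>. mi_order \<alpha> \<le> m \<longrightarrow> F \<alpha> \<in> sq_integrable G) \<and>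
     (\<forall>e>0. \<exists>\<phi>\<in>test_funs G. \<forall>\<alpha>. mi_order \<alpha> \<le> m \<longrightarrow>
        (\<integral>x. (F \<alpha> x - mderiv_rev \<alpha> \<phi> x)\<^sup>2 \<partial>lebesgue_on G) < e)"

lemma is_jet_sq_integrable: "is_jet m G F \<Longrightarrow> mi_order \<alpha> \<le> m \<Longrightarrow> F \<alpha> \<in> sq_integrable G"
  by (simp add: is_jet_def)

lemma is_jet0_sq_integrable: "is_jet0 m G F \<Longrightarrow> mi_order \<alpha> \<le> m \<Longrightarrow> F \<alpha> \<in> sq_integrable G"
  by (simp add: is_jet0_def)

lemma is_jet0_approx:
  assumes "is_jet0 m G F" "e > 0"
  obtains \<phi> where "\<phi> \<in> test_funs G"
    "\<And>\<alpha>. mi_order \<alpha> \<le> m \<Longrightarrow> (\<integral>x. (F \<alpha> x - mderiv_rev \<alpha> \<phi> x)\<^sup>2 \<partial>lebesgue_on G) < e"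
  using assms unfolding is_jet0_def by blast

lemma is_jet0_test_fun:
  assumes "open G" "\<phi> \<in> test_funs G"
  shows "is_jet0 m G (\<lambda>\<alpha>. mderiv_rev \<alpha> \<phi>)"
  using assms by (auto simp: is_jet0_def intro: test_funs_sq_integrable test_funs_mderiv_rev intro!: bexI[of _ \<phi>])

text \<open>A weighted substitute for the Cauchy-Schwarz inequality: |ab| \<le> a^2 / \<delta> +
  \<delta> b^2, integrated. The first term contributes at most \<delta>, which is the added 1, so
  the bound is linear in \<delta>.\<close>

lemma abs_integral_mult_le:
  assumes f: "f \<in> sq_integrable G" and g: "g \<in> sq_integrable G"
    and "\<delta> > 0" and small: "(\<integral>x. (f x)\<^sup>2 \<partial>lebesgue_on G) < \<delta>\<^sup>2"
  shows "\<bar>\<integral>x. f x * g x \<partial>lebesgue_on G\<bar> \<le> \<delta> * ((\<integral>x. (g x)\<^sup>2 \<partial>lebesgue_on G) + 1)"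
proof -
  have le: "\<bar>a * b\<bar> \<le> a\<^sup>2 / \<delta> + \<delta> * b\<^sup>2" for a b :: real
  proof -
    have "2 * (\<bar>a\<bar> * (\<delta> * \<bar>b\<bar>)) \<le> \<bar>a\<bar>\<^sup>2 + (\<delta> * \<bar>b\<bar>)\<^sup>2"
      using sum_squares_bound[of "\<bar>a\<bar>" "\<delta> * \<bar>b\<bar>"] by (simp add: mult.assoc)
    moreover have "0 \<le> \<bar>a\<bar> * (\<delta> * \<bar>b\<bar>)"
      using \<open>\<delta> > 0\<close> by simp
    ultimately have "\<bar>a\<bar> * (\<delta> * \<bar>b\<bar>) \<le> a\<^sup>2 + (\<delta> * \<bar>b\<bar>)\<^sup>2"
      unfolding power2_abs by linarith
    then show ?thesis
      using \<open>\<delta> > 0\<close> by (simp add: abs_mult field_simps power2_eq_square)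
  qed
  have int: "integrable (lebesgue_on G) (\<lambda>x. (f x)\<^sup>2 / \<delta>)" "integrable (lebesgue_on G) (\<lambda>x. \<delta> * (g x)\<^sup>2)"
    using f g by (auto dest: sq_integrableD)
  have "\<bar>\<integral>x. f x * g x \<partial>lebesgue_on G\<bar> \<le> (\<integral>x. \<bar>f x * g x\<bar> \<partial>lebesgue_on G)"
    by (rule integral_abs_bound)
  also have "\<dots> \<le> (\<integral>x. (f x)\<^sup>2 / \<delta> + \<delta> * (g x)\<^sup>2 \<partial>lebesgue_on G)"
    using sq_integrable_mult[OF f g] int le
    by (intro integral_mono integrable_abs Bochner_Integration.integrable_add) auto
  also have "\<dots> = (\<integral>x. (f x)\<^sup>2 \<partial>lebesgue_on G) / \<delta> + \<delta> * (\<integral>x. (g x)\<^sup>2 \<partial>lebesgue_on G)"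
    using int by simp
  also have "\<dots> \<le> \<delta>\<^sup>2 / \<delta> + \<delta> * (\<integral>x. (g x)\<^sup>2 \<partial>lebesgue_on G)"
    using small \<open>\<delta> > 0\<close> by (intro add_right_mono divide_right_mono) auto
  finally show ?thesis
    using \<open>\<delta> > 0\<close> by (simp add: power2_eq_square algebra_simps)
qed

text \<open>Integration by parts gives the identity exactly for test functions, and for fixed \<psi>
  both of its sides are continuous in the L2 norm.\<close>

lemma is_jet0_imp_is_jet:
  assumes "open G" "is_jet0 m G F"
  shows "is_jet m G F"
  unfolding is_jet_def
proof (intro allI impI conjI)
  fix \<alpha> :: "'a \<Rightarrow> nat" assume \<alpha>: "mi_order \<alpha> \<le> m"
  show F: "F \<alpha> \<in> sq_integrable G"
    using is_jet0_sq_integrable[OF assms(2) \<alpha>] .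
  have F0: "F (\<lambda>_. 0) \<in> sq_integrable G"
    using is_jet0_sq_integrable[OF assms(2)] by simp
  let ?s = "(-1) ^ mi_order \<alpha> :: real"
  let ?I = "\<lambda>f. \<integral>x. f x \<partial>lebesgue_on G"
  show "weak_deriv_fun G \<alpha> (F (\<lambda>_. 0)) (F \<alpha>)"
    unfolding weak_deriv_fun_def
  proof
    fix \<psi> assume \<psi>: "\<psi> \<in> test_funs G"
    let ?\<psi>' = "mderiv \<alpha> \<psi>"
    \<comment> \<open>One group for each side of the identity, as supplied by
      \<open>abs_integral_mult_le\<close>. C depends on \<psi> but not on \<delta> or the
      approximation, and the added 1s make it positive.\<close>
    define C where "C = (?I (\<lambda>x. (?\<psi>' x)\<^sup>2) + 1) + (?I (\<lambda>x. (\<psi> x)\<^sup>2) + 1)"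
    define L where "L = ?I (\<lambda>x. F (\<lambda>_. 0) x * ?\<psi>' x) - ?s * ?I (\<lambda>x. F \<alpha> x * \<psi> x)"
    have \<psi>_sq: "\<psi> \<in> sq_integrable G" "?\<psi>' \<in> sq_integrable G"
      using \<psi> assms(1) by (auto intro: test_funs_sq_integrable test_funs_mderiv)
    have "C > 0"
    proof -
      have "0 \<le> ?I (\<lambda>x. (?\<psi>' x)\<^sup>2)" "0 \<le> ?I (\<lambda>x. (\<psi> x)\<^sup>2)"
        by simp_all
      then show ?thesis
        unfolding C_def by linarith
    qed
    have bound: "\<bar>L\<bar> \<le> \<delta> * C" if "\<delta> > 0" for \<delta>
    proof -
      obtain \<phi> where \<phi>: "\<phi> \<in> test_funs G" and small:
        "\<And>\<alpha>. mi_order \<alpha> \<le> m \<Longrightarrow> ?I (\<lambda>x. (F \<alpha> x - mderiv_rev \<alpha> \<phi> x)\<^sup>2) < \<delta>\<^sup>2"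
        using is_jet0_approx[OF assms(2), of "\<delta>\<^sup>2"] \<open>\<delta> > 0\<close> by auto
      let ?\<phi>' = "mderiv_rev \<alpha> \<phi>"
      have \<phi>_sq: "\<phi> \<in> sq_integrable G" "?\<phi>' \<in> sq_integrable G"
        using \<phi> assms(1) by (auto intro: test_funs_sq_integrable test_funs_mderiv_rev)
      let ?A = "?I (\<lambda>x. (F (\<lambda>_. 0) x - \<phi> x) * ?\<psi>' x)" and ?B = "?I (\<lambda>x. (F \<alpha> x - ?\<phi>' x) * \<psi> x)"
      have AB: "?A = ?I (\<lambda>x. F (\<lambda>_. 0) x * ?\<psi>' x) - ?I (\<lambda>x. \<phi> x * ?\<psi>' x)"
        "?B = ?I (\<lambda>x. F \<alpha> x * \<psi> x) - ?I (\<lambda>x. ?\<phi>' x * \<psi> x)"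
        using sq_integrable_mult[OF F0 \<psi>_sq(2)] sq_integrable_mult[OF \<phi>_sq(1) \<psi>_sq(2)]
          sq_integrable_mult[OF F \<psi>_sq(1)] sq_integrable_mult[OF \<phi>_sq(2) \<psi>_sq(1)]
        by (simp_all add: left_diff_distrib)
      have parts: "?I (\<lambda>x. \<phi> x * ?\<psi>' x) = ?s * ?I (\<lambda>x. ?\<phi>' x * \<psi> x)"
        by (rule integral_mderiv_parts[OF assms(1) \<phi> \<psi>])
      \<comment> \<open>By \<open>parts\<close> the two terms with \<phi> cancel, and only the
        approximation errors remain.\<close>
      have "L = ?A - ?s * ?B"
        unfolding L_def AB parts by (simp add: right_diff_distrib)
      then have "\<bar>L\<bar> \<le> \<bar>?A\<bar> + \<bar>?B\<bar>"
        using abs_triangle_ineq4[of ?A "?s * ?B"] by (simp add: abs_mult power_abs)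
      moreover have "\<bar>?A\<bar> \<le> \<delta> * (?I (\<lambda>x. (?\<psi>' x)\<^sup>2) + 1)"
        using small[of "\<lambda>_. 0"] sq_integrable_diff[OF F0 \<phi>_sq(1)] \<psi>_sq(2) \<open>\<delta> > 0\<close>
        by (intro abs_integral_mult_le) auto
      moreover have "\<bar>?B\<bar> \<le> \<delta> * (?I (\<lambda>x. (\<psi> x)\<^sup>2) + 1)"
        using small[OF \<alpha>] sq_integrable_diff[OF F \<phi>_sq(2)] \<psi>_sq(1) \<open>\<delta> > 0\<close>
        by (intro abs_integral_mult_le) auto
      ultimately show ?thesis
        unfolding C_def distrib_left by linarith
    qed
    have "\<bar>L\<bar> \<le> 0 + e" if "e > 0" for e
      using bound[of "e / C"] that \<open>C > 0\<close> by simp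
    then have "L = 0"
      using field_le_epsilon[of "\<bar>L\<bar>" 0] by simp
    then show "?I (\<lambda>x. F (\<lambda>_. 0) x * ?\<psi>' x) = ?s * ?I (\<lambda>x. F \<alpha> x * \<psi> x)"
      by (simp add: L_def)
  qed
qed

lemma weak_deriv_fun_0: "weak_deriv_fun G (\<lambda>_. 0) f f"
  by (simp add: weak_deriv_fun_def)

lemma weak_deriv_fun_diff:
  assumes "open G" "f \<in> sq_integrable G" "g \<in> sq_integrable G" "f' \<in> sq_integrable G" "g' \<in> sq_integrable G"
    and "weak_deriv_fun G \<alpha> f f'" "weak_deriv_fun G \<alpha> g g'"
  shows "weak_deriv_fun G \<alpha> (\<lambda>x. f x - g x) (\<lambda>x. f' x - g' x)"
  unfolding weak_deriv_fun_def
proof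
  fix \<phi> assume \<phi>: "\<phi> \<in> test_funs G"
  have int: "integrable (lebesgue_on G) (\<lambda>x. f x * mderiv \<alpha> \<phi> x)"
    "integrable (lebesgue_on G) (\<lambda>x. g x * mderiv \<alpha> \<phi> x)"
    "integrable (lebesgue_on G) (\<lambda>x. f' x * \<phi> x)" "integrable (lebesgue_on G) (\<lambda>x. g' x * \<phi> x)"
    using assms(1-5) \<phi> by (auto intro!: sq_integrable_mult test_funs_sq_integrable test_funs_mderiv)
  show "(\<integral>x. (f x - g x) * mderiv \<alpha> \<phi> x \<partial>lebesgue_on G) =
      (-1) ^ mi_order \<alpha> * (\<integral>x. (f' x - g' x) * \<phi> x \<partial>lebesgue_on G)"
    using int bspec[OF assms(6)[unfolded weak_deriv_fun_def] \<phi>] bspec[OF assms(7)[unfolded weak_deriv_fun_def] \<phi>]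
    by (simp add: left_diff_distrib right_diff_distrib)
qed

text \<open>Membership in the closure concerns the distance from u to a test function, whose value
  is read off the difference of their jets.\<close>

lemma is_jet_diff:
  assumes "open G" "is_jet m G F" "is_jet m G F'"
  shows "is_jet m G (\<lambda>\<alpha> x. F \<alpha> x - F' \<alpha> x)"
proof -
  have "mi_order (\<lambda>_. 0 :: nat) \<le> m"
    by simp
  then have "F (\<lambda>_. 0) \<in> sq_integrable G" "F' (\<lambda>_. 0) \<in> sq_integrable G"
    using assms(2,3) is_jet_sq_integrable by blast+
  then show ?thesis
    using assms unfolding is_jet_def by (simp add: weak_deriv_fun_diff sq_integrable_diff)
qed

lemma is_jet_Sob:
  assumes "open G" "is_jet m G F"
  shows "cls G (F (\<lambda>_. 0)) \<in> carr (Sob m G)"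
    and "nrm (Sob m G) (cls G (F (\<lambda>_. 0))) =
      sqrt (\<Sum>\<alpha> | mi_order \<alpha> \<le> m. \<integral>x. (F \<alpha> x)\<^sup>2 \<partial>lebesgue_on G)"
proof -
  let ?u = "cls G (F (\<lambda>_. 0))"
  have F0: "F (\<lambda>_. 0) \<in> sq_integrable G"
    using is_jet_sq_integrable[OF assms(2)] by simp
  have "is_weak_deriv G \<alpha> ?u (cls G (F \<alpha>))" if "mi_order \<alpha> \<le> m" for \<alpha>
    using assms(2) that F0 by (simp add: is_jet_def is_weak_deriv_cls)
  then show "?u \<in> carr (Sob m G)"
    using F0 L2_iff unfolding Sob_def by auto
  have "(L2_norm G (weak_deriv G \<alpha> ?u))\<^sup>2 = (\<integral>x. (F \<alpha> x)\<^sup>2 \<partial>lebesgue_on G)" if "mi_order \<alpha> \<le> m" for \<alpha>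
  proof -
    have "F \<alpha> \<in> sq_integrable G" "weak_deriv_fun G \<alpha> (F (\<lambda>_. 0)) (F \<alpha>)"
      using assms(2) that by (auto simp: is_jet_def)
    then show ?thesis
      using weak_deriv_cls[OF assms(1) F0] by (simp add: L2_norm_cls)
  qed
  then show "nrm (Sob m G) ?u = sqrt (\<Sum>\<alpha> | mi_order \<alpha> \<le> m. \<integral>x. (F \<alpha> x)\<^sup>2 \<partial>lebesgue_on G)"
    by (simp add: Sob_def)
qed

lemma Sob_jet:
  assumes "u \<in> carr (Sob m G)"
  obtains F where "is_jet m G F" "u = cls G (F (\<lambda>_. 0))"
proof -
  obtain f where f: "f \<in> sq_integrable G" "u = cls G f"
    using assms by (auto simp: Sob_def L2_iff)
  have "\<exists>g\<in>sq_integrable G. weak_deriv_fun G \<alpha> f g" if "mi_order \<alpha> \<le> m" for \<alpha>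
  proof -
    have "\<exists>w. is_weak_deriv G \<alpha> u w"
      using assms that by (simp add: Sob_def)
    then obtain w where w: "is_weak_deriv G \<alpha> u w" ..
    then obtain g where "g \<in> sq_integrable G" "w = cls G g"
      unfolding is_weak_deriv_def L2_iff by blast
    then show ?thesis
      using w f by (auto simp: is_weak_deriv_cls)
  qed
  then obtain F where F: "\<And>\<alpha>. mi_order \<alpha> \<le> m \<Longrightarrow> F \<alpha> \<in> sq_integrable G \<and> weak_deriv_fun G \<alpha> f (F \<alpha>)"
    by metis
  show ?thesis
  proof
    \<comment> \<open>The function chosen for the zero multi-index need not be f itself, to which
      all other components refer, so it is reset to f.\<close>
    show "is_jet m G (F((\<lambda>_. 0) := f))"
      using F f(1) by (auto simp: is_jet_def weak_deriv_fun_0)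
    show "u = cls G ((F((\<lambda>_. 0) := f)) (\<lambda>_. 0))"
      using f(2) by simp
  qed
qed

lemma nrm_jet_diff_test_fun:
  assumes "open G" "is_jet m G F" "\<phi> \<in> test_funs G"
  shows "nrm (Sob m G) (add (Sob m G) (cls G (F (\<lambda>_. 0))) (scl (Sob m G) (-1) (cls G \<phi>))) =
    sqrt (\<Sum>\<alpha> | mi_order \<alpha> \<le> m. \<integral>x. (F \<alpha> x - mderiv_rev \<alpha> \<phi> x)\<^sup>2 \<partial>lebesgue_on G)"
proof -
  have "F (\<lambda>_. 0) \<in> sq_integrable G"
    using is_jet_sq_integrable[OF assms(2)] by simp
  moreover have \<phi>: "\<phi> \<in> sq_integrable G"
    using assms by (auto intro: test_funs_sq_integrable)
  ultimately have "add (Sob m G) (cls G (F (\<lambda>_. 0))) (scl (Sob m G) (-1) (cls G \<phi>)) =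
      cls G (\<lambda>x. F (\<lambda>_. 0) x - \<phi> x)"
    using Sob_add_cls[OF _ sq_integrable_scale[OF \<phi>, of "-1"]] by (simp add: Sob_scl_cls)
  moreover have "is_jet m G (\<lambda>\<alpha> x. F \<alpha> x - mderiv_rev \<alpha> \<phi> x)"
    by (rule is_jet_diff[OF assms(1,2) is_jet0_imp_is_jet[OF assms(1) is_jet0_test_fun[OF assms(1,3)]]])
  ultimately show ?thesis
    using is_jet_Sob(2)[OF assms(1)] by fastforce
qed

section \<open>The closure of the test functions in terms of jets\<close>

lemma carr_Sob0: "carr (Sob0 m G) = norm_closure (Sob m G) (cls G ` test_funs G)"
  and add_Sob0: "add (Sob0 m G) = add (Sob m G)"
  and scl_Sob0: "scl (Sob0 m G) = scl (Sob m G)"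
  and zer_Sob0: "zer (Sob0 m G) = cls G (\<lambda>x. 0)"
  and nrm_Sob0: "nrm (Sob0 m G) = nrm (Sob m G)"
  by (simp_all add: Sob0_def subsp_def) (simp add: Sob_def)

text \<open>The squared distance to a test function is a finite sum of nonnegative errors, hence
  small exactly if every error is. This costs \<open>sqrt e\<close> in one direction and e^2 / n in
  the other, where n counts the multi-indices of order at most m.\<close>

lemma carr_Sob0_iff:
  assumes "open G"
  shows "u \<in> carr (Sob0 m G) \<longleftrightarrow> (\<exists>F. is_jet0 m G F \<and> u = cls G (F (\<lambda>_. 0)))"
proof
  assume u: "u \<in> carr (Sob0 m G)"
  then have "u \<in> carr (Sob m G)"
    by (simp add: carr_Sob0 norm_closure_def)
  then obtain F where F: "is_jet m G F" "u = cls G (F (\<lambda>_. 0))"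
    by (rule Sob_jet)
  have "\<exists>\<phi>\<in>test_funs G. \<forall>\<alpha>. mi_order \<alpha> \<le> m \<longrightarrow>
        (\<integral>x. (F \<alpha> x - mderiv_rev \<alpha> \<phi> x)\<^sup>2 \<partial>lebesgue_on G) < e" if "e > 0" for e
  proof -
    let ?I = "\<lambda>\<phi> \<alpha>. \<integral>x. (F \<alpha> x - mderiv_rev \<alpha> \<phi> x)\<^sup>2 \<partial>lebesgue_on G"
    have "sqrt e > 0"
      using that by simp
    then obtain \<phi> where \<phi>: "\<phi> \<in> test_funs G"
      "nrm (Sob m G) (add (Sob m G) u (scl (Sob m G) (-1) (cls G \<phi>))) < sqrt e"
      using u unfolding carr_Sob0 norm_closure_def by blast
    then have "sqrt (\<Sum>\<alpha> | mi_order \<alpha> \<le> m. ?I \<phi> \<alpha>) < sqrt e"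
      using nrm_jet_diff_test_fun[OF assms F(1)] F(2) by simp
    then have sum: "(\<Sum>\<alpha> | mi_order \<alpha> \<le> m. ?I \<phi> \<alpha>) < e"
      by simp
    have "?I \<phi> \<alpha> < e" if "mi_order \<alpha> \<le> m" for \<alpha>
    proof -
      have "?I \<phi> \<alpha> \<le> (\<Sum>\<alpha> | mi_order \<alpha> \<le> m. ?I \<phi> \<alpha>)"
        using that by (intro member_le_sum finite_mi_order_le) auto
      then show ?thesis
        using sum by linarith
    qed
    then show ?thesis
      using \<phi>(1) by blast
  qed
  then have "is_jet0 m G F"
    using is_jet_sq_integrable[OF F(1)] by (simp add: is_jet0_def)
  then show "\<exists>F. is_jet0 m G F \<and> u = cls G (F (\<lambda>_. 0))"
    using F(2) by blast
next
  assume "\<exists>F. is_jet0 m G F \<and> u = cls G (F (\<lambda>_. 0))"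
  then obtain F where F: "is_jet0 m G F" "u = cls G (F (\<lambda>_. 0))"
    by blast
  note jet = is_jet0_imp_is_jet[OF assms F(1)]
  show "u \<in> carr (Sob0 m G)"
    unfolding carr_Sob0 norm_closure_def
  proof (intro CollectI conjI allI impI)
    show "u \<in> carr (Sob m G)"
      using is_jet_Sob(1)[OF assms jet] F(2) by simp
    fix e :: real assume "e > 0"
    let ?n = "real (card {\<alpha> :: 'a \<Rightarrow> nat. mi_order \<alpha> \<le> m})"
    have zero_mem: "(\<lambda>_. 0) \<in> {\<alpha> :: 'a \<Rightarrow> nat. mi_order \<alpha> \<le> m}"
      by simp
    then have "?n > 0"
      using finite_mi_order_le[of m] by (simp only: of_nat_0_less_iff card_gt_0_iff) blast
    with \<open>e > 0\<close> have "e\<^sup>2 / ?n > 0"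
      by simp
    then obtain \<phi> where \<phi>: "\<phi> \<in> test_funs G"
      "\<And>\<alpha>. mi_order \<alpha> \<le> m \<Longrightarrow> (\<integral>x. (F \<alpha> x - mderiv_rev \<alpha> \<phi> x)\<^sup>2 \<partial>lebesgue_on G) < e\<^sup>2 / ?n"
      using is_jet0_approx[OF F(1)] by blast
    have "(\<Sum>\<alpha> | mi_order \<alpha> \<le> m. \<integral>x. (F \<alpha> x - mderiv_rev \<alpha> \<phi> x)\<^sup>2 \<partial>lebesgue_on G) <
        (\<Sum>\<alpha> | mi_order (\<alpha> :: 'a \<Rightarrow> nat) \<le> m. e\<^sup>2 / ?n)"
      using \<phi>(2) zero_mem by (intro sum_strict_mono finite_mi_order_le) blast+
    also have "\<dots> = e\<^sup>2"
      using \<open>?n > 0\<close> by simp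
    finally have "sqrt (\<Sum>\<alpha> | mi_order \<alpha> \<le> m. \<integral>x. (F \<alpha> x - mderiv_rev \<alpha> \<phi> x)\<^sup>2 \<partial>lebesgue_on G) < e"
      using \<open>e > 0\<close> real_less_rsqrt real_sqrt_less_mono by fastforce
    then show "\<exists>a\<in>cls G ` test_funs G. nrm (Sob m G) (add (Sob m G) u (scl (Sob m G) (-1) a)) < e"
      using \<phi>(1) nrm_jet_diff_test_fun[OF assms jet \<phi>(1)]
      unfolding F(2) by (intro bexI[of _ "cls G \<phi>"]) auto
  qed
qed

lemma is_jet0_add:
  assumes "open G" "is_jet0 m G F" "is_jet0 m G F'"
  shows "is_jet0 m G (\<lambda>\<alpha> x. F \<alpha> x + F' \<alpha> x)"
  unfolding is_jet0_def
proof (intro conjI allI impI)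
  show "(\<lambda>x. F \<alpha> x + F' \<alpha> x) \<in> sq_integrable G" if "mi_order \<alpha> \<le> m" for \<alpha>
    using that assms by (intro sq_integrable_add is_jet0_sq_integrable)
  fix e :: real assume "e > 0"
  \<comment> \<open>The quarter comes from (p + q)^2 \<le> 2 p^2 + 2 q^2, applied to two
    errors.\<close>
  then have "e / 4 > 0"
    by simp
  obtain \<phi> where \<phi>: "\<phi> \<in> test_funs G"
    "\<And>\<alpha>. mi_order \<alpha> \<le> m \<Longrightarrow> (\<integral>x. (F \<alpha> x - mderiv_rev \<alpha> \<phi> x)\<^sup>2 \<partial>lebesgue_on G) < e / 4"
    using is_jet0_approx[OF assms(2) \<open>e / 4 > 0\<close>] by blast
  obtain \<psi> where \<psi>: "\<psi> \<in> test_funs G"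
    "\<And>\<alpha>. mi_order \<alpha> \<le> m \<Longrightarrow> (\<integral>x. (F' \<alpha> x - mderiv_rev \<alpha> \<psi> x)\<^sup>2 \<partial>lebesgue_on G) < e / 4"
    using is_jet0_approx[OF assms(3) \<open>e / 4 > 0\<close>] by blast
  have "(\<integral>x. (F \<alpha> x + F' \<alpha> x - mderiv_rev \<alpha> (\<lambda>x. \<phi> x + \<psi> x) x)\<^sup>2 \<partial>lebesgue_on G) < e"
    if \<alpha>: "mi_order \<alpha> \<le> m" for \<alpha>
  proof -
    let ?a = "\<lambda>x. F \<alpha> x - mderiv_rev \<alpha> \<phi> x" and ?b = "\<lambda>x. F' \<alpha> x - mderiv_rev \<alpha> \<psi> x"
    have ab: "?a \<in> sq_integrable G" "?b \<in> sq_integrable G"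
      by (intro sq_integrable_diff is_jet0_sq_integrable[OF assms(2) \<alpha>] is_jet0_sq_integrable[OF assms(3) \<alpha>]
          test_funs_sq_integrable[OF test_funs_mderiv_rev[OF \<phi>(1)] assms(1)]
          test_funs_sq_integrable[OF test_funs_mderiv_rev[OF \<psi>(1)] assms(1)])+
    have "(\<integral>x. (?a x + ?b x)\<^sup>2 \<partial>lebesgue_on G) \<le> (\<integral>x. 2 * (?a x)\<^sup>2 + 2 * (?b x)\<^sup>2 \<partial>lebesgue_on G)"
    proof (rule integral_mono)
      show "integrable (lebesgue_on G) (\<lambda>x. (?a x + ?b x)\<^sup>2)"
        by (rule sq_integrableD(2)[OF sq_integrable_add[OF ab]])
      show "integrable (lebesgue_on G) (\<lambda>x. 2 * (?a x)\<^sup>2 + 2 * (?b x)\<^sup>2)"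
        using ab by (intro Bochner_Integration.integrable_add integrable_mult_right sq_integrableD(2))
      have "(p + q)\<^sup>2 \<le> 2 * p\<^sup>2 + 2 * q\<^sup>2" for p q :: real
        using sum_squares_bound[of p q] by (simp add: power2_sum)
      then show "(?a x + ?b x)\<^sup>2 \<le> 2 * (?a x)\<^sup>2 + 2 * (?b x)\<^sup>2" for x .
    qed
    also have "\<dots> = 2 * (\<integral>x. (?a x)\<^sup>2 \<partial>lebesgue_on G) + 2 * (\<integral>x. (?b x)\<^sup>2 \<partial>lebesgue_on G)"
      using sq_integrableD(2)[OF ab(1)] sq_integrableD(2)[OF ab(2)] by simp
    also have "\<dots> < e"
      using \<phi>(2)[OF \<alpha>] \<psi>(2)[OF \<alpha>] by linarith
    finally show ?thesis
      using mderiv_rev_add[OF \<phi>(1) \<psi>(1)] by (simp add: algebra_simps)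
  qed
  then show "\<exists>\<phi>\<in>test_funs G. \<forall>\<alpha>. mi_order \<alpha> \<le> m \<longrightarrow>
      (\<integral>x. (F \<alpha> x + F' \<alpha> x - mderiv_rev \<alpha> \<phi> x)\<^sup>2 \<partial>lebesgue_on G) < e"
    using test_funs_add[OF \<phi>(1) \<psi>(1)] by blast
qed

lemma is_jet0_scale:
  assumes "is_jet0 m G F"
  shows "is_jet0 m G (\<lambda>\<alpha> x. c * F \<alpha> x)"
  unfolding is_jet0_def
proof (intro conjI allI impI)
  show "(\<lambda>x. c * F \<alpha> x) \<in> sq_integrable G" if "mi_order \<alpha> \<le> m" for \<alpha>
    using that assms by (intro sq_integrable_scale is_jet0_sq_integrable)
  fix e :: real assume "e > 0"
  \<comment> \<open>The errors scale by c^2; adding 1 allows the division also for c = 0.\<close>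
  have pos: "c\<^sup>2 + 1 > 0"
    by (simp add: add_nonneg_pos)
  then have "e / (c\<^sup>2 + 1) > 0"
    using \<open>e > 0\<close> by simp
  then obtain \<phi> where \<phi>: "\<phi> \<in> test_funs G"
    "\<And>\<alpha>. mi_order \<alpha> \<le> m \<Longrightarrow> (\<integral>x. (F \<alpha> x - mderiv_rev \<alpha> \<phi> x)\<^sup>2 \<partial>lebesgue_on G) < e / (c\<^sup>2 + 1)"
    using is_jet0_approx[OF assms] by blast
  have "(\<integral>x. (c * F \<alpha> x - mderiv_rev \<alpha> (\<lambda>x. c * \<phi> x) x)\<^sup>2 \<partial>lebesgue_on G) < e"
    if \<alpha>: "mi_order \<alpha> \<le> m" for \<alpha>
  proof -
    let ?J = "\<integral>x. (F \<alpha> x - mderiv_rev \<alpha> \<phi> x)\<^sup>2 \<partial>lebesgue_on G"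
    have "(\<integral>x. (c * F \<alpha> x - mderiv_rev \<alpha> (\<lambda>x. c * \<phi> x) x)\<^sup>2 \<partial>lebesgue_on G) =
        (\<integral>x. c\<^sup>2 * (F \<alpha> x - mderiv_rev \<alpha> \<phi> x)\<^sup>2 \<partial>lebesgue_on G)"
      using mderiv_rev_scale[OF \<phi>(1)] by (simp flip: right_diff_distrib add: power_mult_distrib)
    also have "\<dots> = c\<^sup>2 * ?J"
      by simp
    also have "\<dots> \<le> (c\<^sup>2 + 1) * ?J"
      by (simp add: mult_right_mono)
    also have "\<dots> < e"
      using \<phi>(2)[OF \<alpha>] pos by (simp add: field_simps)
    finally show ?thesis .
  qed
  then show "\<exists>\<phi>\<in>test_funs G. \<forall>\<alpha>. mi_order \<alpha> \<le> m \<longrightarrow>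
      (\<integral>x. (c * F \<alpha> x - mderiv_rev \<alpha> \<phi> x)\<^sup>2 \<partial>lebesgue_on G) < e"
    using test_funs_scale[OF \<phi>(1)] by blast
qed

text \<open>Serves the linearity of the adjoint: \<open>adj\<close> is given by its formula on the
  carrier only, so sums must be known to lie there.\<close>

lemma Sob0_add_closed:
  assumes "open G" "u \<in> carr (Sob0 m G)" "v \<in> carr (Sob0 m G)"
  shows "add (Sob0 m G) u v \<in> carr (Sob0 m G)"
proof -
  obtain F where F: "is_jet0 m G F" "u = cls G (F (\<lambda>_. 0))"
    using assms(2) unfolding carr_Sob0_iff[OF assms(1)] by blast
  obtain F' where F': "is_jet0 m G F'" "v = cls G (F' (\<lambda>_. 0))"
    using assms(3) unfolding carr_Sob0_iff[OF assms(1)] by blast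
  have "add (Sob0 m G) u v = cls G (\<lambda>x. F (\<lambda>_. 0) x + F' (\<lambda>_. 0) x)"
    using F F' by (simp add: add_Sob0 Sob_add_cls is_jet0_sq_integrable)
  then show ?thesis
    using is_jet0_add[OF assms(1) F(1) F'(1)] unfolding carr_Sob0_iff[OF assms(1)] by blast
qed

lemma Sob0_scl_closed:
  assumes "open G" "u \<in> carr (Sob0 m G)"
  shows "scl (Sob0 m G) c u \<in> carr (Sob0 m G)"
proof -
  obtain F where F: "is_jet0 m G F" "u = cls G (F (\<lambda>_. 0))"
    using assms carr_Sob0_iff by blast
  have "scl (Sob0 m G) c u = cls G (\<lambda>x. c * F (\<lambda>_. 0) x)"
    using F by (simp add: scl_Sob0 Sob_scl_cls is_jet0_sq_integrable)
  then show ?thesis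
    using is_jet0_scale[OF F(1)] unfolding carr_Sob0_iff[OF assms(1)] by blast
qed

text \<open>Makes the index set of the supremum in \<open>dual_norm\<close> nonempty; a bump on a
  box inside G is a witness.\<close>

lemma Sob0_nonzero:
  assumes "open G" "G \<noteq> {}"
  shows "\<exists>u\<in>carr (Sob0 m G). u \<noteq> zer (Sob0 m G)"
proof -
  obtain x where "x \<in> G"
    using assms(2) by blast
  then obtain a b where ab: "cbox a b \<subseteq> G" "x \<in> box a b"
    using open_contains_cbox[of G x] assms(1) by metis
  let ?\<phi> = "box_bump 1 a b"
  have \<phi>: "?\<phi> \<in> test_funs G"
    using ab(1) by (intro box_bump_test_fun) auto
  have "cls G ?\<phi> \<noteq> cls G (\<lambda>x. 0)"
  proof
    assume "cls G ?\<phi> = cls G (\<lambda>x. 0)"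
    then have "AE x in lebesgue_on G. ?\<phi> x = 0"
      using \<phi> assms(1) test_funs_sq_integrable test_funs_zero by (subst (asm) cls_eq_iff) blast+
    then have "AE x in lebesgue. x \<in> G \<longrightarrow> ?\<phi> x = 0"
      using assms(1) by (simp add: AE_restrict_space_iff)
    \<comment> \<open>The bump is positive on the whole open box, which would thus be a nonempty
      open null set.\<close>
    then have "AE x in lebesgue. x \<notin> box a b"
    proof eventually_elim
      case (elim y)
      then show ?case
        using box_bump_pos_iff[of 1 a b y] ab(1) box_subset_cbox[of a b] by auto
    qed
    then have "negligible (box a b)"
      by (simp add: AE_iff_null_sets[symmetric] negligible_iff_null_sets)
    then show False
      using ab(2) open_box open_not_negligible by fastforce
  qed
  moreover have "cls G ?\<phi> \<in> carr (Sob0 m G)"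
    unfolding carr_Sob0_iff[OF assms(1)]
    using is_jet0_test_fun[OF assms(1) \<phi>] by (intro exI[of _ "\<lambda>\<alpha>. mderiv_rev \<alpha> ?\<phi>"]) simp
  ultimately show ?thesis
    unfolding zer_Sob0 by blast
qed


section \<open>Extension by zero\<close>

lemma integral_extend_zero:
  fixes f :: "real^'d::finite \<Rightarrow> real"
  assumes "open G" "open G'" "G \<subseteq> G'"
  shows "(\<integral>x. (if x \<in> G then f x else 0) \<partial>lebesgue_on G') = (\<integral>x. f x \<partial>lebesgue_on G)"
proof -
  have "(\<integral>x. (if x \<in> G then f x else 0) \<partial>lebesgue_on G') = (\<integral>x. (if x \<in> G then f x else 0) \<partial>lebesgue)"
    using assms by (intro integral_lebesgue_on_open) auto
  also have "\<dots> = (\<integral>x. f x \<partial>lebesgue_on G)"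
    using assms(1) by (simp add: integral_restrict_space indicator_times_eq_if)
  finally show ?thesis .
qed

lemma sq_integrable_extend_zero:
  assumes "open G" "open G'" "G \<subseteq> G'" "f \<in> sq_integrable G"
  shows "(\<lambda>x. if x \<in> G then f x else 0) \<in> sq_integrable G'"
proof -
  let ?f = "\<lambda>x. if x \<in> G then f x else 0"
  have "?f \<in> borel_measurable lebesgue"
    using assms(1) sq_integrableD(1)[OF assms(4)] by (simp add: borel_measurable_if)
  then have "?f \<in> borel_measurable (lebesgue_on G')"
    by (rule measurable_restrict_space1)
  moreover have "integrable lebesgue (\<lambda>x. indicator G x *\<^sub>R (f x)\<^sup>2)"
    using assms(1) sq_integrableD(2)[OF assms(4)] by (simp add: integrable_restrict_space)
  then have "integrable lebesgue (\<lambda>x. indicator G' x *\<^sub>R (?f x)\<^sup>2)"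
    by (rule back_subst[of "integrable lebesgue"]) (use assms(3) in \<open>auto simp: indicator_def fun_eq_iff\<close>)
  then have "integrable (lebesgue_on G') (\<lambda>x. (?f x)\<^sup>2)"
    using assms(2) by (simp add: integrable_restrict_space)
  ultimately show ?thesis
    by (simp add: sq_integrable_def)
qed

text \<open>From right to left this makes the extension independent of the representative; from left
  to right it makes it injective on classes.\<close>

lemma AE_extend_zero_iff:
  assumes "open G" "open G'" "G \<subseteq> G'"
  shows "(AE x in lebesgue_on G'. (if x \<in> G then f x else 0) = (if x \<in> G then g x else 0)) \<longleftrightarrow>
    (AE x in lebesgue_on G. f x = g x)"
proof -
  have "(AE x in lebesgue_on G'. (if x \<in> G then f x else 0) = (if x \<in> G then g x else 0)) \<longleftrightarrow>
      (AE x in lebesgue. x \<in> G' \<longrightarrow> (if x \<in> G then f x else 0) = (if x \<in> G then g x else 0))"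
    using assms(2) by (simp add: AE_restrict_space_iff)
  also have "\<dots> \<longleftrightarrow> (AE x in lebesgue. x \<in> G \<longrightarrow> f x = g x)"
    using assms(3) by (intro AE_cong) auto
  also have "\<dots> \<longleftrightarrow> (AE x in lebesgue_on G. f x = g x)"
    using assms(1) by (simp add: AE_restrict_space_iff)
  finally show ?thesis .
qed

lemma zero_ext_cls:
  assumes "open G" "open G'" "G \<subseteq> G'" "f \<in> sq_integrable G"
  shows "zero_ext G G' (cls G f) = cls G' (\<lambda>x. if x \<in> G then f x else 0)"
  unfolding zero_ext_def
  using assms rep_cls[OF assms(4)]
  by (simp add: cls_eq_iff sq_integrable_extend_zero AE_extend_zero_iff)

text \<open>The same \<phi> serves: its derivatives vanish off G, so the error on the larger set is
  the zero extension of the error on G.\<close>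

lemma is_jet0_extend_zero:
  assumes "open G" "open G'" "G \<subseteq> G'" "is_jet0 m G F"
  shows "is_jet0 m G' (\<lambda>\<alpha> x. if x \<in> G then F \<alpha> x else 0)"
  unfolding is_jet0_def
proof (intro conjI allI impI)
  show "(\<lambda>x. if x \<in> G then F \<alpha> x else 0) \<in> sq_integrable G'" if "mi_order \<alpha> \<le> m" for \<alpha>
    using that assms by (intro sq_integrable_extend_zero is_jet0_sq_integrable)
  fix e :: real assume "e > 0"
  then obtain \<phi> where \<phi>: "\<phi> \<in> test_funs G"
    "\<And>\<alpha>. mi_order \<alpha> \<le> m \<Longrightarrow> (\<integral>x. (F \<alpha> x - mderiv_rev \<alpha> \<phi> x)\<^sup>2 \<partial>lebesgue_on G) < e"
    using is_jet0_approx[OF assms(4)] by blast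
  have "(\<integral>x. ((if x \<in> G then F \<alpha> x else 0) - mderiv_rev \<alpha> \<phi> x)\<^sup>2 \<partial>lebesgue_on G') < e"
    if "mi_order \<alpha> \<le> m" for \<alpha>
  proof -
    have "(\<lambda>x. ((if x \<in> G then F \<alpha> x else 0) - mderiv_rev \<alpha> \<phi> x)\<^sup>2) =
        (\<lambda>x. if x \<in> G then (F \<alpha> x - mderiv_rev \<alpha> \<phi> x)\<^sup>2 else 0)"
      using test_funs_zero_outside[OF test_funs_mderiv_rev[OF \<phi>(1)]] by (auto simp: fun_eq_iff)
    then show ?thesis
      using \<phi>(2)[OF that] assms(1-3) by (simp add: integral_extend_zero)
  qed
  then show "\<exists>\<phi>\<in>test_funs G'. \<forall>\<alpha>. mi_order \<alpha> \<le> m \<longrightarrow>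
      (\<integral>x. ((if x \<in> G then F \<alpha> x else 0) - mderiv_rev \<alpha> \<phi> x)\<^sup>2 \<partial>lebesgue_on G') < e"
    using \<phi>(1) test_funs_mono[OF assms(3)] by blast
qed

text \<open>An extended jet is still a limit of jets of test functions, hence a jet on G', and the
  norms agree component by component. For a general element of H^m a jump across the boundary of G
  could prevent this.\<close>

lemma zero_ext_Sob0:
  assumes "open G" "open G'" "G \<subseteq> G'" "u \<in> carr (Sob0 m G)"
  shows "zero_ext G G' u \<in> carr (Sob0 m G')"
    and "nrm (Sob0 m G') (zero_ext G G' u) = nrm (Sob0 m G) u"
proof -
  obtain F where F: "is_jet0 m G F" "u = cls G (F (\<lambda>_. 0))"
    using assms carr_Sob0_iff by blast
  let ?F = "\<lambda>\<alpha> x. if x \<in> G then F \<alpha> x else 0"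
  have jet: "is_jet0 m G' ?F"
    using is_jet0_extend_zero[OF assms(1-3) F(1)] .
  have E: "zero_ext G G' u = cls G' (?F (\<lambda>_. 0))"
    using F assms(1-3) by (simp add: zero_ext_cls is_jet0_sq_integrable)
  then show "zero_ext G G' u \<in> carr (Sob0 m G')"
    using jet unfolding carr_Sob0_iff[OF assms(2)] by blast
  have "(\<integral>x. (?F \<alpha> x)\<^sup>2 \<partial>lebesgue_on G') = (\<integral>x. (F \<alpha> x)\<^sup>2 \<partial>lebesgue_on G)" for \<alpha>
    using integral_extend_zero[OF assms(1-3), of "\<lambda>x. (F \<alpha> x)\<^sup>2"]
    by (simp add: if_distrib[of "\<lambda>y. y\<^sup>2"] cong: if_cong)
  then show "nrm (Sob0 m G') (zero_ext G G' u) = nrm (Sob0 m G) u"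
    unfolding nrm_Sob0 E unfolding F(2)
    using is_jet_Sob(2)[OF assms(2) is_jet0_imp_is_jet[OF assms(2) jet]]
      is_jet_Sob(2)[OF assms(1) is_jet0_imp_is_jet[OF assms(1) F(1)]] by simp
qed

lemma Sob0_cls:
  assumes "open G" "u \<in> carr (Sob0 m G)"
  obtains f where "f \<in> sq_integrable G" "u = cls G f"
  using assms by (metis carr_Sob0_iff is_jet0_sq_integrable mi_order_0 zero_le)

lemma zero_ext_add:
  assumes "open G" "open G'" "G \<subseteq> G'" "u \<in> carr (Sob0 m G)" "v \<in> carr (Sob0 m G)"
  shows "zero_ext G G' (add (Sob0 m G) u v) = add (Sob0 m G') (zero_ext G G' u) (zero_ext G G' v)"
proof -
  obtain f g where f: "f \<in> sq_integrable G" "u = cls G f" and g: "g \<in> sq_integrable G" "v = cls G g"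
    using assms Sob0_cls by metis
  have "(\<lambda>x. if x \<in> G then f x + g x else 0) = (\<lambda>x. (if x \<in> G then f x else 0) + (if x \<in> G then g x else 0))"
    by auto
  then show ?thesis
    using assms(1-3) f g
    by (simp add: add_Sob0 Sob_add_cls zero_ext_cls sq_integrable_add sq_integrable_extend_zero)
qed

lemma zero_ext_scl:
  assumes "open G" "open G'" "G \<subseteq> G'" "u \<in> carr (Sob0 m G)"
  shows "zero_ext G G' (scl (Sob0 m G) c u) = scl (Sob0 m G') c (zero_ext G G' u)"
proof -
  obtain f where f: "f \<in> sq_integrable G" "u = cls G f"
    using assms Sob0_cls by metis
  have "(\<lambda>x. if x \<in> G then c * f x else 0) = (\<lambda>x. c * (if x \<in> G then f x else 0))"
    by auto
  then show ?thesis
    using assms(1-3) f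
    by (simp add: scl_Sob0 Sob_scl_cls zero_ext_cls sq_integrable_scale sq_integrable_extend_zero)
qed

lemma zero_ext_inj_on:
  assumes "open G" "open G'" "G \<subseteq> G'"
  shows "inj_on (zero_ext G G') (L2 G)"
proof (rule inj_onI)
  fix u v assume "u \<in> L2 G" "v \<in> L2 G" and eq: "zero_ext G G' u = zero_ext G G' v"
  then obtain f g where fg: "f \<in> sq_integrable G" "u = cls G f" "g \<in> sq_integrable G" "v = cls G g"
    unfolding L2_iff by blast
  then show "u = v"
    using eq assms by (simp add: zero_ext_cls cls_eq_iff sq_integrable_extend_zero AE_extend_zero_iff)
qed

text \<open>Keeps the extension of a nonzero element inside the index set of the larger
  supremum.\<close>

lemma zero_ext_eq_zer:
  assumes "open G" "open G'" "G \<subseteq> G'" "u \<in> carr (Sob0 m G)"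
    and "zero_ext G G' u = zer (Sob0 m G')"
  shows "u = zer (Sob0 m G)"
proof -
  have zero: "(\<lambda>x. 0) \<in> sq_integrable G"
    using test_funs_sq_integrable[OF test_funs_zero assms(1)] .
  then have "zero_ext G G' u = zero_ext G G' (cls G (\<lambda>x. 0))"
    using assms by (simp add: zer_Sob0 zero_ext_cls)
  moreover have "u \<in> L2 G" "cls G (\<lambda>x. 0) \<in> L2 G"
    using Sob0_cls[OF assms(1,4)] zero L2_iff by metis+
  ultimately show ?thesis
    using zero_ext_inj_on[OF assms(1-3)] by (simp add: inj_on_def zer_Sob0)
qed


section \<open>Dual norms\<close>

text \<open>A real \<open>Sup\<close> is an upper bound only for sets bounded above; here the
  boundedness of the functional enters.\<close>

lemma dual_quotient_bdd_above:
  assumes "g \<in> dual Y"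
  shows "bdd_above ((\<lambda>v. g v / nrm Y v) ` (carr Y - {zer Y}))"
proof -
  obtain C where C: "\<And>u. u \<in> carr Y \<Longrightarrow> \<bar>g u\<bar> \<le> C * nrm Y u"
    using assms unfolding dual_def by blast
  \<comment> \<open>The record carries no norm axioms: the sign of \<open>nrm\<close> is unknown,
    hence the absolute values, and a vanishing norm gives the quotient 0.\<close>
  have "g v / nrm Y v \<le> \<bar>C\<bar>" if "v \<in> carr Y" for v
  proof (cases "nrm Y v = 0")
    case False
    have "g v / nrm Y v \<le> \<bar>g v / nrm Y v\<bar>"
      by (rule abs_ge_self)
    also have "\<dots> = \<bar>g v\<bar> / \<bar>nrm Y v\<bar>"
      by simp
    also have "\<dots> \<le> \<bar>C * nrm Y v\<bar> / \<bar>nrm Y v\<bar>"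
      using C[OF that] by (intro divide_right_mono) auto
    also have "\<dots> = \<bar>C\<bar>"
      using False by (simp add: abs_mult)
    finally show ?thesis .
  qed simp
  then show ?thesis
    by (intro bdd_aboveI[of _ "\<bar>C\<bar>"]) auto
qed

text \<open>The quotient of f at v equals that of g at \<open>T v\<close>, which is nonzero and so
  takes part in the second supremum. Both inequalities of the theorem are instances, with T the
  extension from D to \<Omega> and from \<Omega> to Q.\<close>

lemma dual_norm_le_isometry:
  assumes "g \<in> dual Y" "\<exists>u\<in>carr X. u \<noteq> zer X"
    and T: "\<And>u. u \<in> carr X \<Longrightarrow> T u \<in> carr Y" "\<And>u. u \<in> carr X \<Longrightarrow> nrm Y (T u) = nrm X u"
      "\<And>u. u \<in> carr X \<Longrightarrow> T u = zer Y \<Longrightarrow> u = zer X"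
    and f: "\<And>u. u \<in> carr X \<Longrightarrow> f u = g (T u)"
  shows "dual_norm X f \<le> dual_norm Y g"
  unfolding dual_norm_def
proof (rule cSUP_least)
  show "carr X - {zer X} \<noteq> {}"
    using assms(2) by blast
  fix v assume v: "v \<in> carr X - {zer X}"
  then have "g (T v) / nrm Y (T v) \<le> (SUP w\<in>carr Y - {zer Y}. g w / nrm Y w)"
    using T by (intro cSUP_upper dual_quotient_bdd_above assms(1)) auto
  then show "f v / nrm X v \<le> (SUP w\<in>carr Y - {zer Y}. g w / nrm Y w)"
    using v T(2) f by simp
qed

theorem corollary3p10:
  fixes D \<Omega> Q :: "(real^'d::finite) set" and m :: nat
    and r\<^sub>\<Omega> :: "'d fclass \<Rightarrow> real"
  assumes "domain D" and "domain \<Omega>" and "domain Q"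
    and "D \<subseteq> \<Omega>" and "\<Omega> \<subseteq> Q"
    and "r\<^sub>\<Omega> \<in> dual (Sob0 m \<Omega>)"
  shows
    "let E\<^sub>D = zero_ext D \<Omega>;
         E\<^sub>Q = zero_ext \<Omega> Q;
         V = E\<^sub>D ` carr (Sob0 m D);
         U = E\<^sub>Q ` carr (Sob0 m \<Omega>);
         R\<^sub>Q = inv_into (carr (Sob0 m \<Omega>)) E\<^sub>Q;
         r\<^sub>D = adj (Sob0 m D) E\<^sub>D (restrict r\<^sub>\<Omega> V)
     in r\<^sub>D \<in> dual (Sob0 m D) \<and>
        dual_norm (Sob0 m D) r\<^sub>D \<le> dual_norm (Sob0 m \<Omega>) r\<^sub>\<Omega> \<and>
        (\<forall>r\<^sub>Q \<in> extensions (Sob0 m Q) U (adj (subsp (Sob0 m Q) U) R\<^sub>Q r\<^sub>\<Omega>).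
           dual_norm (Sob0 m \<Omega>) r\<^sub>\<Omega> \<le> dual_norm (Sob0 m Q) r\<^sub>Q)"
proof -
  have opens: "open D" "open \<Omega>" "open Q" "D \<noteq> {}" "\<Omega> \<noteq> {}"
    using assms(1-3) by (auto simp: domain_def)
  note E\<^sub>D = opens(1,2) assms(4) and E\<^sub>Q = opens(2,3) assms(5)
  define r\<^sub>D where "r\<^sub>D = adj (Sob0 m D) (zero_ext D \<Omega>) (restrict r\<^sub>\<Omega> (zero_ext D \<Omega> ` carr (Sob0 m D)))"
  \<comment> \<open>The restriction to V does not show, as the extension of u lies in V.\<close>
  have r\<^sub>D: "r\<^sub>D u = r\<^sub>\<Omega> (zero_ext D \<Omega> u)" if "u \<in> carr (Sob0 m D)" for u
    using that by (simp add: r\<^sub>D_def adj_def)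
  have "r\<^sub>D \<in> dual (Sob0 m D)"
  proof -
    have "r\<^sub>D \<in> extensional (carr (Sob0 m D))"
      by (simp add: r\<^sub>D_def adj_def)
    moreover have "r\<^sub>D (add (Sob0 m D) u v) = r\<^sub>D u + r\<^sub>D v"
      if "u \<in> carr (Sob0 m D)" "v \<in> carr (Sob0 m D)" for u v
      using that assms(6) zero_ext_Sob0(1)[OF E\<^sub>D]
      by (simp add: r\<^sub>D Sob0_add_closed[OF opens(1)] zero_ext_add[OF E\<^sub>D] dual_def)
    moreover have "r\<^sub>D (scl (Sob0 m D) c u) = c * r\<^sub>D u" if "u \<in> carr (Sob0 m D)" for c u
      using that assms(6) zero_ext_Sob0(1)[OF E\<^sub>D]
      by (simp add: r\<^sub>D Sob0_scl_closed[OF opens(1)] zero_ext_scl[OF E\<^sub>D] dual_def)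
    moreover have "\<exists>C. \<forall>u\<in>carr (Sob0 m D). \<bar>r\<^sub>D u\<bar> \<le> C * nrm (Sob0 m D) u"
    proof -
      obtain C where "\<And>u. u \<in> carr (Sob0 m \<Omega>) \<Longrightarrow> \<bar>r\<^sub>\<Omega> u\<bar> \<le> C * nrm (Sob0 m \<Omega>) u"
        using assms(6) unfolding dual_def by blast
      \<comment> \<open>The same C serves because extension by zero preserves the norm.\<close>
      then have "\<bar>r\<^sub>D u\<bar> \<le> C * nrm (Sob0 m D) u" if "u \<in> carr (Sob0 m D)" for u
        using that zero_ext_Sob0[OF E\<^sub>D that] by (metis r\<^sub>D)
      then show ?thesis
        by blast
    qed
    ultimately show ?thesis
      by (simp add: dual_def)
  qed
  moreover have "dual_norm (Sob0 m D) r\<^sub>D \<le> dual_norm (Sob0 m \<Omega>) r\<^sub>\<Omega>"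
    using assms(6) Sob0_nonzero[OF opens(1,4)] zero_ext_Sob0[OF E\<^sub>D] zero_ext_eq_zer[OF E\<^sub>D] r\<^sub>D
    by (rule dual_norm_le_isometry)
  moreover have "dual_norm (Sob0 m \<Omega>) r\<^sub>\<Omega> \<le> dual_norm (Sob0 m Q) r\<^sub>Q"
    if r\<^sub>Q: "r\<^sub>Q \<in> extensions (Sob0 m Q) (zero_ext \<Omega> Q ` carr (Sob0 m \<Omega>))
      (adj (subsp (Sob0 m Q) (zero_ext \<Omega> Q ` carr (Sob0 m \<Omega>)))
        (inv_into (carr (Sob0 m \<Omega>)) (zero_ext \<Omega> Q)) r\<^sub>\<Omega>)" for r\<^sub>Q
  proof -
    \<comment> \<open>Injectivity makes \<open>inv_into\<close> a left inverse, so that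
      \<open>r\<^sub>Q\<close> composed with extension by zero is \<open>r\<^sub>\<Omega>\<close> on
      the carrier.\<close>
    have inj: "inj_on (zero_ext \<Omega> Q) (carr (Sob0 m \<Omega>))"
      using zero_ext_inj_on[OF E\<^sub>Q] by (rule inj_on_subset) (metis L2_iff Sob0_cls[OF opens(2)] subsetI)
    have "r\<^sub>\<Omega> u = r\<^sub>Q (zero_ext \<Omega> Q u)" if "u \<in> carr (Sob0 m \<Omega>)" for u
      using r\<^sub>Q that inj by (simp add: extensions_def adj_def subsp_def)
    moreover have "r\<^sub>Q \<in> dual (Sob0 m Q)"
      using r\<^sub>Q by (simp add: extensions_def)
    ultimately show ?thesis
      using Sob0_nonzero[OF opens(2,5)] zero_ext_Sob0[OF E\<^sub>Q] zero_ext_eq_zer[OF E\<^sub>Q]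
      by (intro dual_norm_le_isometry[where T = "zero_ext \<Omega> Q"]) auto
  qed
  ultimately show ?thesis
    unfolding Let_def r\<^sub>D_def by blast
qed

end
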